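(* Let $\lambda,\mu\vdash n$ (with $n\ge 2$), let $i$ be a part of $\lambda$ and $j$ a part of $\mu$, and let $C\in\mathfrak{S}_n$ be an $n$-cycle. Then the number of factorizations $C=\sigma_1\sigma_2$ with $\sigma_1\in\mathcal{C}_{\lambda,i}$ and $\sigma_2\in\mathcal{C}_{\mu,j}$ is \[ \frac{|\mathcal{C}_{\lambda,i}|\,|\mathcal{C}_{\mu,j}|}{(n-1)^2\,n!}\sum_{1\le k\le n-1}\frac{(-1)^{k-1}}{\binom{n-2}{k-1}}\,[x^ky^k]\,T_{n,i,j}(x,y)\,H_{\lambda\setminus i}(x)\,H_{\mu\setminus j}(y), \] where $T_{n,i,j}(x,y)=xy\,R_{n,i}(x)R_{n,j}(y)-S_{n,i}(x)S_{n,j}(y)$, with \[ R_{n,j}(x)=\frac{(n-1)+nx+(-x)^j}{1+x},\qquad S_{n,j}(x)=(-1)^{j-1}\frac{(-1)^jx+nx^j+(n-1)x^{j+1}}{1+x}. \]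
   Context: For $\lambda\vdash n$ and a part $i$ of $\lambda$, $\mathcal{C}_{\lambda,i}$ is the set of permutations in $\mathfrak{S}_n$ of cycle type $\lambda$ in which $n$ lies on a cycle of length $i$. For a partition $\nu=(\nu_1,\ldots,\nu_m)$, $H_\nu(y)=\prod_{r=1}^m(1-(-y)^{\nu_r})$, and $\lambda\setminus i$ is the partition obtained from $\lambda$ by deleting one part equal to $i$. $[x^ky^k]$ denotes coefficient extraction in the power series ring in $x,y$ ($R_{n,j}$ and $S_{n,j}$ are polynomials).
   Formalization: The formula fails as printed (n=3, λ=(1,1,1), i=1, μ=(2,1), j=2 gives -3/2 instead of 0); the theorem proved has H_{λ\i}(x) and H_{μ\j}(y) divided by 1+x and 1+y respectively. *)

theory Defs
  imports
    Complex_Main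
    "HOL-Library.Multiset"
    "HOL-Combinatorics.Permutations"
    "HOL-Combinatorics.Orbits"
    "HOL-Computational_Algebra.Formal_Power_Series"
begin

definition is_partition_of :: "nat multiset \<Rightarrow> nat \<Rightarrow> bool" where
  "is_partition_of nu n \<longleftrightarrow> 0 \<notin># nu \<and> sum_mset nu = n"

text \<open>
  Permutations in the symmetric group of degree \<open>n\<close> are functions that permute \<open>{1..n}\<close>.
  The multiset below has one entry per cycle, because \<open>orbit p ` {1..n}\<close> is the set
  of supports of the cycles (fixed points included).
\<close>

definition cycle_type :: "nat \<Rightarrow> (nat \<Rightarrow> nat) \<Rightarrow> nat multiset" where
  "cycle_type n p = image_mset card (mset_set (orbit p ` {1..n}))"

definition marked_class :: "nat \<Rightarrow> nat multiset \<Rightarrow> nat \<Rightarrow> (nat \<Rightarrow> nat) set" where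
  "marked_class n lam i =
     {p. p permutes {1..n} \<and> cycle_type n p = lam \<and> card (orbit p n) = i}"

definition H_series :: "nat multiset \<Rightarrow> real fps" where
  "H_series nu = (\<Prod>r\<in>#nu. 1 - (- fps_X) ^ r)"

definition R_series :: "nat \<Rightarrow> nat \<Rightarrow> real fps" where
  "R_series n j = ((of_nat n - 1) + of_nat n * fps_X + (- fps_X) ^ j) / (1 + fps_X)"

definition S_series :: "nat \<Rightarrow> nat \<Rightarrow> real fps" where
  "S_series n j =
     (- 1) ^ (j - 1) *
     (((- 1) ^ j * fps_X + of_nat n * fps_X ^ j + (of_nat n - 1) * fps_X ^ (j + 1)) / (1 + fps_X))"

text \<open>
  Power series in \<open>x\<close> and \<open>y\<close> are series in the outer variable \<open>y\<close> whose coefficients are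
  series in the inner variable \<open>x\<close>; \<open>in_x f\<close> is \<open>f(x)\<close> and \<open>in_y f\<close> is \<open>f(y)\<close>.
\<close>

definition in_x :: "real fps \<Rightarrow> real fps fps" where
  "in_x f = fps_const f"

definition in_y :: "real fps \<Rightarrow> real fps fps" where
  "in_y f = Abs_fps (\<lambda>m. fps_const (fps_nth f m))"

definition coeff_xy :: "real fps fps \<Rightarrow> nat \<Rightarrow> nat \<Rightarrow> real" where
  "coeff_xy F a b = fps_nth (fps_nth F b) a"

definition T_series :: "nat \<Rightarrow> nat \<Rightarrow> nat \<Rightarrow> real fps fps" where
  "T_series n i j =
     in_x fps_X * in_y fps_X * in_x (R_series n i) * in_y (R_series n j)
     - in_x (S_series n i) * in_y (S_series n j)"

text \<open>
  Pitfall: in the counting formula the product \<open>H_series nu\<close> has to be divided by \<open>1 + x\<close>.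
  It is \<open>H_series nu / (1 + x)\<close> that generates the hook characters (the traces on
  the exterior powers of the standard representation). Without this division the formula fails: for
  \<open>n = 3\<close>, \<open>lam = {#1, 1, 1#}\<close>, \<open>i = 1\<close>, \<open>mu = {#2, 1#}\<close>, \<open>j = 2\<close> it evaluates to
  \<open>-3/2\<close>, while there is no such factorization.
\<close>

end

theory Submission
  imports Defs "HOL-Combinatorics.Cycles" "HOL-Computational_Algebra.Polynomial_FPS"
begin

text \<open>
  Let \<open>V\<close> be the standard representation of the symmetric group. Then \<open>det (1 - s)\<close> on \<open>V\<close>, the
  alternating sum of the traces on the exterior powers of \<open>V\<close>, is \<open>n\<close> if \<open>s\<close> is an \<open>n\<close>-cycle and \<open>0\<close>
  otherwise. Since the stabilizer of \<open>n\<close> acts simply transitively on the \<open>n\<close>-cycles, \<open>n!\<close> times the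
  number of factorizations is the alternating sum of the traces of \<open>\<Lambda>\<^sup>k(A) \<Lambda>\<^sup>k(B)\<close>, where
  \<open>\<Lambda>\<^sup>k(A)\<close> is the sum of the operators of the elements of a marked class \<open>A\<close>. These operators commute
  with the stabilizer of \<open>n\<close>, which permutes the basis \<open>e\<^sub>a - e\<^sub>n\<close> of \<open>V\<close>; its commutant on
  \<open>\<Lambda>\<^sup>k V\<close> is two-dimensional, so each operator is determined by two traces. The generating functions
  of these traces are obtained from the Faddeev-LeVerrier recursion and the numbers of fixed points
  of the powers of a permutation; they are \<open>S\<close> and \<open>R\<close> times \<open>H\<close> divided by \<open>1 + x\<close>.
\<close>

unbundle fps_syntax

section \<open>Minors indexed by tuples\<close>

text \<open>Under the stabilizer of n, V is the permutation module on n - 1 points: the trivial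
  module plus a sum-zero part W of dimension n - 2. So the k-th exterior power of V splits into the
  exterior powers of W of degrees k and k - 1, whence the two-dimensional commutant. The derivation
  D induced by the all-ones matrix is 0 on the first summand and n - 1 on the second, so the trace
  against D, divided by n - 1, is the trace on the second. A class operator is a scalar on each
  summand; the trace of a product of two is there the product of the traces over the dimension,
  binom(n-2, k) or binom(n-2, k-1). Up to the factor n - 1, \<open>R_series\<close> belongs to the
  first summand and \<open>S_series\<close> to the second. In the alternating sum, a shift of k by
  one in the R part makes the dimensions agree; it produces both the factor xy and the minus sign in
  T. Exterior powers are never constructed: an operator is given by its matrix coefficients, an
  alternating function of two tuples.\<close>

definition minor :: "nat \<Rightarrow> ('a \<Rightarrow> 'b \<Rightarrow> real) \<Rightarrow> (nat \<Rightarrow> 'a) \<Rightarrow> (nat \<Rightarrow> 'b) \<Rightarrow> real" where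
  "minor k M f g = (\<Sum>p | p permutes {..<k}. of_int (sign p) * (\<Prod>i<k. M (f i) (g (p i))))"

text \<open>Tuples instead of subsets avoid choosing an order on \<open>S\<close>. Each k-subset is
  then listed k! times, which is the origin of the factors \<open>fact k\<close>.\<close>

definition tuples :: "nat \<Rightarrow> 'a set \<Rightarrow> (nat \<Rightarrow> 'a) set" where
  "tuples k S = PiE {..<k} (\<lambda>_. S)"

definition id_mat :: "'a \<Rightarrow> 'a \<Rightarrow> real" where
  "id_mat a b = (if a = b then 1 else 0)"

lemma minor_cong:
  assumes "\<And>i. i < k \<Longrightarrow> f i = f' i" "\<And>i. i < k \<Longrightarrow> g i = g' i"
  shows "minor k M f g = minor k M f' g'"
  unfolding minor_def
proof (rule sum.cong[OF refl])
  fix p assume "p \<in> {p. p permutes {..<k}}"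
  then have p: "p i < k" if "i < k" for i
    using that permutes_in_image by fastforce
  show "of_int (sign p) * (\<Prod>i<k. M (f i) (g (p i))) = of_int (sign p) * (\<Prod>i<k. M (f' i) (g' (p i)))"
    using assms p by simp
qed

lemma sign_mult_compose:
  assumes "p permutes {..<k::nat}" "q permutes {..<k}"
  shows "sign (p \<circ> q) = sign p * sign q"
  using assms by (intro sign_compose) (auto intro: permutation_permutes[THEN iffD2])

lemma of_int_sign_square: "real_of_int (sign p) * (real_of_int (sign p) * x) = x"
  by (simp add: sign_def)

lemma minor_col_perm:
  assumes q: "q permutes {..<k}"
  shows "minor k M f (g \<circ> q) = of_int (sign q) * minor k M f g"
proof -
  have "minor k M f g = (\<Sum>p | p permutes {..<k}.
      of_int (sign (q \<circ> p)) * (\<Prod>i<k. M (f i) (g ((q \<circ> p) i))))"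
    unfolding minor_def
    by (rule sum.reindex_bij_witness[where i = "\<lambda>p. q \<circ> p" and j = "\<lambda>p. inv q \<circ> p"])
      (use q in \<open>auto simp: permutes_compose permutes_inv o_assoc permutes_inv_o permutes_inverses\<close>)
  also have "\<dots> = of_int (sign q) * minor k M f (g \<circ> q)"
    unfolding minor_def sum_distrib_left
    by (intro sum.cong refl) (auto simp: sign_mult_compose[OF q] mult_ac)
  finally show ?thesis by (simp add: of_int_sign_square)
qed

lemma minor_row_perm:
  assumes q: "q permutes {..<k}"
  shows "minor k M (f \<circ> q) g = of_int (sign q) * minor k M f g"
proof -
  have "minor k M (f \<circ> q) g = (\<Sum>p | p permutes {..<k}.
      of_int (sign (p \<circ> q)) * (\<Prod>i<k. M ((f \<circ> q) i) (g ((p \<circ> q) i))))"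
    unfolding minor_def
    by (rule sum_permutations_compose_right[OF q,
          of "\<lambda>p. of_int (sign p) * (\<Prod>i<k. M ((f \<circ> q) i) (g (p i)))"])
  also have "\<dots> = of_int (sign q) * minor k M f g"
    unfolding minor_def sum_distrib_left
  proof (intro sum.cong refl)
    fix p assume p: "p \<in> {p. p permutes {..<k}}"
    have "(\<Prod>i<k. M ((f \<circ> q) i) (g ((p \<circ> q) i))) = (\<Prod>i<k. M (f i) (g (p i)))"
      using prod.permute[OF q, of "\<lambda>i. M (f i) (g (p i))"] by (simp add: o_def)
    then show "of_int (sign (p \<circ> q)) * (\<Prod>i<k. M ((f \<circ> q) i) (g ((p \<circ> q) i)))
      = of_int (sign q) * (of_int (sign p) * (\<Prod>i<k. M (f i) (g (p i))))"
      using p q by (simp add: sign_mult_compose)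
  qed
  finally show ?thesis .
qed

lemma minor_0 [simp]: "minor 0 M f g = 1"
  by (simp add: minor_def)

text \<open>Laplace expansion along the last row. Column j is not deleted but overwritten by the
  last column; this costs one transposition, so all terms with j < k carry the same sign.\<close>

lemma minor_Suc:
  "minor (Suc k) M f g =
     M (f k) (g k) * minor k M f g - (\<Sum>j<k. M (f k) (g j) * minor k M f (g(j := g k)))"
proof -
  define h where "h p = of_int (sign p) * (\<Prod>i<Suc k. M (f i) (g (p i)))" for p :: "nat \<Rightarrow> nat"
  have block: "(\<Sum>q | q permutes {..<k}. h (transpose k j \<circ> q)) =
      of_int (sign (transpose k j)) * (M (f k) (g j) * minor k M f (g \<circ> transpose k j))"
    if "j \<le> k" for j
    unfolding minor_def sum_distrib_left
  proof (intro sum.cong refl)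
    fix q assume q: "q \<in> {q. q permutes {..<k}}"
    then have qk: "q k = k" by (auto simp: permutes_def)
    have "q permutes {..<Suc k}"
      using q by (auto intro: permutes_subset)
    moreover have "transpose k j permutes {..<Suc k}"
      using that by (intro permutes_swap_id) auto
    ultimately have "sign (transpose k j \<circ> q) = sign (transpose k j) * sign q"
      by (intro sign_mult_compose)
    then show "h (transpose k j \<circ> q) = of_int (sign (transpose k j)) *
        (M (f k) (g j) * (of_int (sign q) * (\<Prod>i<k. M (f i) ((g \<circ> transpose k j) (q i)))))"
      by (simp add: h_def qk mult_ac)
  qed
  have ins: "{..<Suc k} = insert k {..<k}" by auto
  have "minor (Suc k) M f g = (\<Sum>p | p permutes {..<Suc k}. h p)"
    unfolding minor_def h_def ..
  also have "\<dots> = (\<Sum>j\<in>insert k {..<k}. \<Sum>q | q permutes {..<k}. h (transpose k j \<circ> q))"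
    unfolding ins by (rule sum_over_permutations_insert) auto
  also have "\<dots> = (\<Sum>j\<in>insert k {..<k}. of_int (sign (transpose k j)) *
      (M (f k) (g j) * minor k M f (g \<circ> transpose k j)))"
    by (intro sum.cong refl block) auto
  also have "\<dots> = M (f k) (g k) * minor k M f g +
      (\<Sum>j<k. - (M (f k) (g j) * minor k M f (g(j := g k))))"
  proof -
    have "minor k M f (g \<circ> transpose k j) = minor k M f (g(j := g k))" if "j < k" for j
      by (rule minor_cong) (use that in \<open>auto simp: transpose_def\<close>)
    then show ?thesis
      by (simp add: sign_swap_id)
  qed
  finally show ?thesis by (simp add: sum_negf)
qed

section \<open>Sums over tuples and the Cauchy-Binet formula\<close>

lemma finite_tuples [simp]: "finite S \<Longrightarrow> finite (tuples k S)"
  unfolding tuples_def by (intro finite_PiE) auto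

lemma tuples_perm:
  assumes "q permutes {..<k}" "f \<in> tuples k S"
  shows "f \<circ> q \<in> tuples k S"
  using assms permutes_in_image[OF assms(1)]
  by (auto simp: tuples_def PiE_iff extensional_def permutes_def)

lemma sum_tuples_perm:
  assumes q: "q permutes {..<k}"
  shows "(\<Sum>f\<in>tuples k S. h (f \<circ> q)) = (\<Sum>f\<in>tuples k S. h f)"
  by (rule sum.reindex_bij_witness[where i = "\<lambda>f. f \<circ> inv q" and j = "\<lambda>f. f \<circ> q"])
    (use q in \<open>auto simp: tuples_perm permutes_inv o_assoc[symmetric] permutes_inv_o\<close>)

lemma sum_tuples_Suc:
  assumes "finite S"
  shows "(\<Sum>f\<in>tuples (Suc k) S. h f) = (\<Sum>f\<in>tuples k S. \<Sum>a\<in>S. h (f(k := a)))"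
proof -
  have "{..<Suc k} = insert k {..<k}" by auto
  then have "tuples (Suc k) S = (\<lambda>(a, f). f(k := a)) ` (S \<times> tuples k S)"
    by (simp add: tuples_def PiE_insert_eq)
  moreover have "inj_on (\<lambda>(a, f). f(k := a)) (S \<times> tuples k S)"
    unfolding tuples_def by (rule inj_combinator) auto
  ultimately have "(\<Sum>f\<in>tuples (Suc k) S. h f) = (\<Sum>(a, f)\<in>S \<times> tuples k S. h (f(k := a)))"
    by (simp add: sum.reindex split_def)
  also have "\<dots> = (\<Sum>f\<in>tuples k S. \<Sum>a\<in>S. h (f(k := a)))"
    by (subst sum.cartesian_product[symmetric]) (rule sum.swap)
  finally show ?thesis .
qed

text \<open>Reindexing the tuples by p turns the term of p into that of the identity, because
  \<open>G\<close> absorbs the sign. So all k! terms of the minor contribute equally.\<close>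

lemma sum_tuples_alternating:
  assumes S: "finite S"
    and row: "\<And>f q. q permutes {..<k} \<Longrightarrow> G (f \<circ> q) = of_int (sign q) * G f"
  shows "(\<Sum>g\<in>tuples k S. minor k M f g * G g)
    = fact k * (\<Sum>g\<in>tuples k S. (\<Prod>i<k. M (f i) (g i)) * G g)"
proof -
  have "(\<Sum>g\<in>tuples k S. minor k M f g * G g)
    = (\<Sum>p | p permutes {..<k}. \<Sum>g\<in>tuples k S. of_int (sign p) * (\<Prod>i<k. M (f i) (g (p i))) * G g)"
    unfolding minor_def sum_distrib_right by (rule sum.swap)
  also have "\<dots> = (\<Sum>p | p permutes {..<k}. \<Sum>g\<in>tuples k S. (\<Prod>i<k. M (f i) (g i)) * G g)"
  proof (rule sum.cong[OF refl])
    fix p assume "p \<in> {p. p permutes {..<k}}"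
    then have p: "p permutes {..<k}" by simp
    have "(\<Sum>g\<in>tuples k S. (\<Prod>i<k. M (f i) (g i)) * G g)
      = (\<Sum>g\<in>tuples k S. (\<Prod>i<k. M (f i) ((g \<circ> p) i)) * G (g \<circ> p))"
      by (rule sum_tuples_perm[OF p, symmetric])
    then show "(\<Sum>g\<in>tuples k S. of_int (sign p) * (\<Prod>i<k. M (f i) (g (p i))) * G g)
      = (\<Sum>g\<in>tuples k S. (\<Prod>i<k. M (f i) (g i)) * G g)"
      by (simp add: row[OF p] mult_ac)
  qed
  also have "\<dots> = fact k * (\<Sum>g\<in>tuples k S. (\<Prod>i<k. M (f i) (g i)) * G g)"
    by (simp add: card_permutations[of "{..<k}" k])
  finally show ?thesis .
qed

text \<open>Expanding the minor of the product gives one diagonal product per tuple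
  \<open>g\<close>. As \<open>minor k N g h\<close> alternates in \<open>g\<close>, these can be
  completed to full minors at the cost of k!.\<close>

lemma Cauchy_Binet_tuples:
  assumes S: "finite S"
  shows "(\<Sum>g\<in>tuples k S. minor k M f g * minor k N g h)
    = fact k * minor k (\<lambda>a b. \<Sum>c\<in>S. M a c * N c b) f h"
proof -
  have "minor k (\<lambda>a b. \<Sum>c\<in>S. M a c * N c b) f h
    = (\<Sum>p | p permutes {..<k}. of_int (sign p) *
        (\<Sum>g\<in>tuples k S. \<Prod>i<k. M (f i) (g i) * N (g i) (h (p i))))"
    unfolding minor_def tuples_def by (subst prod_sum_PiE) (auto simp: S)
  also have "\<dots> = (\<Sum>g\<in>tuples k S. (\<Prod>i<k. M (f i) (g i)) * minor k N g h)"
    unfolding minor_def sum_distrib_left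
    by (subst sum.swap) (simp add: prod.distrib mult_ac)
  finally show ?thesis
    by (simp add: sum_tuples_alternating[OF S] minor_row_perm)
qed

text \<open>On alternating functions the kernel \<open>minor k id_mat\<close> is k! times the
  identity. Members of \<open>tuples k S\<close> are extensional and \<open>f\<close> is arbitrary,
  so \<open>G\<close> has to depend on the first k entries only.\<close>

lemma sum_tuples_minor_id:
  assumes S: "finite S" and f: "\<And>i. i < k \<Longrightarrow> f i \<in> S"
    and row: "\<And>f q. q permutes {..<k} \<Longrightarrow> G (f \<circ> q) = of_int (sign q) * G f"
    and cong: "\<And>f f'. (\<And>i. i < k \<Longrightarrow> f i = f' i) \<Longrightarrow> G f = G f'"
  shows "(\<Sum>g\<in>tuples k S. minor k id_mat f g * G g) = fact k * G f"
proof -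
  let ?f = "restrict f {..<k}"
  have f': "?f \<in> tuples k S" using f by (auto simp: tuples_def)
  have "(\<Prod>i<k. id_mat (f i) (g i)) = (if g = ?f then 1 else 0)" if "g \<in> tuples k S" for g
  proof (cases "g = ?f")
    case False
    have "\<exists>i<k. f i \<noteq> g i"
    proof (rule ccontr)
      assume "\<not> (\<exists>i<k. f i \<noteq> g i)"
      then have "g = ?f"
        using that f' unfolding tuples_def by (intro PiE_ext[of g "{..<k}" "\<lambda>_. S" ?f]) auto
      with False show False ..
    qed
    then show ?thesis using False by (auto simp: id_mat_def intro!: prod_zero)
  qed (simp add: id_mat_def)
  then have "(\<Sum>g\<in>tuples k S. (\<Prod>i<k. id_mat (f i) (g i)) * G g)
    = (\<Sum>g\<in>tuples k S. if g = ?f then G g else 0)"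
    by (intro sum.cong) auto
  also have "\<dots> = G ?f" using S f' by simp
  also have "\<dots> = G f" by (rule cong) simp
  finally show ?thesis
    using sum_tuples_alternating[OF S, of k G id_mat f] row by simp
qed

section \<open>Alternating invariant forms\<close>

text \<open>Matrix coefficients of an operator on the k-th exterior power of the permutation module
  on \<open>S\<close> that commutes with the permutations of \<open>S\<close>. The first clause
  reflects that only the first k values of a tuple are meant.\<close>

definition alt_inv :: "nat \<Rightarrow> 'a set \<Rightarrow> ((nat \<Rightarrow> 'a) \<Rightarrow> (nat \<Rightarrow> 'a) \<Rightarrow> real) \<Rightarrow> bool" where
  "alt_inv k S F \<longleftrightarrow>
     (\<forall>f g f' g'. (\<forall>i<k. f i = f' i \<and> g i = g' i) \<longrightarrow> F f g = F f' g') \<and>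
     (\<forall>f g q. q permutes {..<k} \<longrightarrow> F (f \<circ> q) g = of_int (sign q) * F f g) \<and>
     (\<forall>f g q. q permutes {..<k} \<longrightarrow> F f (g \<circ> q) = of_int (sign q) * F f g) \<and>
     (\<forall>f g w. w permutes S \<longrightarrow> F (w \<circ> f) (w \<circ> g) = F f g)"

text \<open>Composition with the derivation induced by the all-ones matrix: each entry in turn is
  replaced by the sum of all basis vectors. For \<open>minor k id_mat\<close> the result is the
  derivation itself.\<close>

definition polarize ::
  "nat \<Rightarrow> 'a set \<Rightarrow> ((nat \<Rightarrow> 'a) \<Rightarrow> (nat \<Rightarrow> 'a) \<Rightarrow> real) \<Rightarrow> (nat \<Rightarrow> 'a) \<Rightarrow> (nat \<Rightarrow> 'a) \<Rightarrow> real" where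
  "polarize k S F f g = (\<Sum>s<k. \<Sum>b\<in>S. F (f(s := b)) g)"

lemma alt_inv_cong:
  assumes "alt_inv k S F" "\<And>i. i < k \<Longrightarrow> f i = f' i" "\<And>i. i < k \<Longrightarrow> g i = g' i"
  shows "F f g = F f' g'"
  using assms(1) unfolding alt_inv_def using assms(2,3) by blast

lemma alt_inv_row: "alt_inv k S F \<Longrightarrow> q permutes {..<k} \<Longrightarrow> F (f \<circ> q) g = of_int (sign q) * F f g"
  unfolding alt_inv_def by blast

lemma alt_inv_col: "alt_inv k S F \<Longrightarrow> q permutes {..<k} \<Longrightarrow> F f (g \<circ> q) = of_int (sign q) * F f g"
  unfolding alt_inv_def by blast

lemma alt_inv_inv: "alt_inv k S F \<Longrightarrow> w permutes S \<Longrightarrow> F (w \<circ> f) (w \<circ> g) = F f g"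
  unfolding alt_inv_def by blast

lemma alt_inv_diff:
  assumes F: "alt_inv k S F" and G: "alt_inv k S G"
  shows "alt_inv k S (\<lambda>f g. F f g - G f g)"
  unfolding alt_inv_def
proof (intro conjI allI impI)
  fix f g f' g' :: "nat \<Rightarrow> 'a" assume "\<forall>i<k. f i = f' i \<and> g i = g' i"
  then have "F f g = F f' g'" "G f g = G f' g'"
    using alt_inv_cong[OF F, of f f' g g'] alt_inv_cong[OF G, of f f' g g'] by auto
  then show "F f g - G f g = F f' g' - G f' g'" by simp
qed (simp_all add: alt_inv_row[OF F] alt_inv_row[OF G] alt_inv_col[OF F] alt_inv_col[OF G]
    alt_inv_inv[OF F] alt_inv_inv[OF G] right_diff_distrib)

lemma alt_inv_scale:
  assumes F: "alt_inv k S F"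
  shows "alt_inv k S (\<lambda>f g. c * F f g)"
  unfolding alt_inv_def
proof (intro conjI allI impI)
  fix f g f' g' :: "nat \<Rightarrow> 'a" assume "\<forall>i<k. f i = f' i \<and> g i = g' i"
  then show "c * F f g = c * F f' g'"
    using alt_inv_cong[OF F, of f f' g g'] by auto
qed (simp_all add: alt_inv_row[OF F] alt_inv_col[OF F] alt_inv_inv[OF F])

lemma alt_inv_polarize:
  assumes F: "alt_inv k S F"
  shows "alt_inv k S (polarize k S F)"
  unfolding alt_inv_def
proof (intro conjI allI impI)
  fix f g f' g' :: "nat \<Rightarrow> 'a" assume "\<forall>i<k. f i = f' i \<and> g i = g' i"
  then show "polarize k S F f g = polarize k S F f' g'"
    unfolding polarize_def by (intro sum.cong refl alt_inv_cong[OF F]) auto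
next
  fix f g :: "nat \<Rightarrow> 'a" and q assume q: "q permutes {..<k}"
  have *: "(f \<circ> q)(s := b) = f(q s := b) \<circ> q" for s b
    using permutes_inj[OF q] by (auto simp: fun_eq_iff inj_eq)
  have "polarize k S F (f \<circ> q) g = (\<Sum>s<k. of_int (sign q) * (\<Sum>b\<in>S. F (f(q s := b)) g))"
    unfolding polarize_def * by (simp add: alt_inv_row[OF F q] sum_distrib_left)
  also have "\<dots> = (\<Sum>s<k. of_int (sign q) * (\<Sum>b\<in>S. F (f(s := b)) g))"
    using sum.permute[OF q, of "\<lambda>s. of_int (sign q) * (\<Sum>b\<in>S. F (f(s := b)) g)"]
    by (simp add: o_def)
  finally show "polarize k S F (f \<circ> q) g = of_int (sign q) * polarize k S F f g"
    by (simp add: polarize_def sum_distrib_left)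
next
  fix f g :: "nat \<Rightarrow> 'a" and q assume q: "q permutes {..<k}"
  show "polarize k S F f (g \<circ> q) = of_int (sign q) * polarize k S F f g"
    by (simp add: polarize_def alt_inv_col[OF F q] sum_distrib_left)
next
  fix f g :: "nat \<Rightarrow> 'a" and w assume w: "w permutes S"
  have *: "w \<circ> f(s := b) = (w \<circ> f)(s := w b)" for s b
    by auto
  have "(\<Sum>b\<in>S. F ((w \<circ> f)(s := b)) (w \<circ> g)) = (\<Sum>b\<in>S. F (f(s := b)) g)" for s
  proof -
    have "(\<Sum>b\<in>S. F ((w \<circ> f)(s := b)) (w \<circ> g)) = (\<Sum>b\<in>S. F ((w \<circ> f)(s := w b)) (w \<circ> g))"
      using sum.permute[OF w, of "\<lambda>b. F ((w \<circ> f)(s := b)) (w \<circ> g)"] by (simp add: o_def)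
    then show ?thesis
      by (simp only: *[symmetric] alt_inv_inv[OF F w])
  qed
  then show "polarize k S F (w \<circ> f) (w \<circ> g) = polarize k S F f g"
    by (simp add: polarize_def)
qed

text \<open>Exchanging two equal entries leaves the tuple unchanged but reverses the sign.\<close>

lemma alt_inv_noninj:
  assumes F: "alt_inv k S F" and "\<not> inj_on f {..<k} \<or> \<not> inj_on g {..<k}"
  shows "F f g = 0"
proof -
  have *: "\<exists>s t. s < k \<and> t < k \<and> s \<noteq> t \<and> h \<circ> transpose s t = h"
    if "\<not> inj_on h {..<k}" for h :: "nat \<Rightarrow> 'a"
  proof -
    from that obtain s t where "s < k" "t < k" "s \<noteq> t" "h s = h t"
      by (auto simp: inj_on_def)
    then show ?thesis by (intro exI[of _ s] exI[of _ t]) (auto simp: fun_eq_iff transpose_def)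
  qed
  show ?thesis
    using assms(2)
  proof
    assume "\<not> inj_on f {..<k}"
    then obtain s t where st: "s < k" "t < k" "s \<noteq> t" and f: "f \<circ> transpose s t = f"
      using * by blast
    have "transpose s t permutes {..<k}" using st by (intro permutes_swap_id) auto
    from alt_inv_row[OF F this, of f g] show ?thesis using st by (simp add: f sign_swap_id)
  next
    assume "\<not> inj_on g {..<k}"
    then obtain s t where st: "s < k" "t < k" "s \<noteq> t" and g: "g \<circ> transpose s t = g"
      using * by blast
    have "transpose s t permutes {..<k}" using st by (intro permutes_swap_id) auto
    from alt_inv_col[OF F this, of f g] show ?thesis using st by (simp add: g sign_swap_id)
  qed
qed

lemma permutes_of_same_image:
  assumes "inj_on f K" "inj_on h K" "f ` K = h ` K"
  obtains q where "q permutes K" "\<And>i. i \<in> K \<Longrightarrow> f i = h (q i)"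
proof
  let ?q = "\<lambda>i. if i \<in> K then inv_into K h (f i) else i"
  have "bij_betw (inv_into K h \<circ> f) K K"
    using assms by (metis bij_betw_def bij_betw_inv_into bij_betw_trans)
  then have "bij_betw ?q K K"
    by (rule bij_betw_cong[THEN iffD1, rotated]) simp
  then show "?q permutes K" by (rule bij_imp_permutes) simp
  show "f i = h (?q i)" if "i \<in> K" for i
    using that assms(3) by (simp add: f_inv_into_f) (metis f_inv_into_f imageI)
qed

text \<open>The two images have complements of equal size in \<open>S\<close>, and any bijection
  between these completes the partial map.\<close>

lemma permutes_extending:
  assumes S: "finite S" and f: "inj_on f J" "f ` J \<subseteq> S" and g: "inj_on g J" "g ` J \<subseteq> S"
  obtains w where "w permutes S" "\<And>i. i \<in> J \<Longrightarrow> w (f i) = g i"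
proof -
  have "card (S - f ` J) = card (S - g ` J)"
    using f g S by (simp add: card_Diff_subset finite_subset card_image)
  then obtain h where h: "bij_betw h (S - f ` J) (S - g ` J)"
    using S finite_same_card_bij by blast
  let ?w = "\<lambda>x. if x \<in> f ` J then g (inv_into J f x) else if x \<in> S then h x else x"
  have "bij_betw (g \<circ> inv_into J f) (f ` J) (g ` J)"
    using f(1) g(1) by (meson bij_betw_imageI bij_betw_inv_into bij_betw_trans)
  then have "bij_betw ?w (f ` J) (g ` J)"
    by (rule bij_betw_cong[THEN iffD1, rotated]) simp
  moreover have "bij_betw ?w (S - f ` J) (S - g ` J)"
    using h by (rule bij_betw_cong[THEN iffD1, rotated]) simp
  ultimately have "bij_betw ?w (f ` J \<union> (S - f ` J)) (g ` J \<union> (S - g ` J))"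
    by (rule bij_betw_combine) auto
  moreover have "f ` J \<union> (S - f ` J) = S" "g ` J \<union> (S - g ` J) = S"
    using f g by auto
  ultimately have "bij_betw ?w S S" by simp
  then have "?w permutes S"
    by (rule bij_imp_permutes) (use f in auto)
  moreover have "?w (f i) = g i" if "i \<in> J" for i
    using that f(1) by simp
  ultimately show ?thesis using that by blast
qed

text \<open>
  If two entries of \<open>f\<close> are missing from \<open>g\<close>, exchanging them fixes \<open>g\<close> and changes the sign of
  \<open>F f g\<close>. So an alternating invariant form lives on the pairs whose ranges differ in at most one
  element.
\<close>

lemma alt_inv_eq_0:
  assumes F: "alt_inv k S F"
    and f: "f ` {..<k} \<subseteq> S" and g: "g ` {..<k} \<subseteq> S"
    and diag: "\<And>f. inj_on f {..<k} \<Longrightarrow> f ` {..<k} \<subseteq> S \<Longrightarrow> F f f = 0"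
    and adj: "\<And>f s b. inj_on f {..<k} \<Longrightarrow> f ` {..<k} \<subseteq> S \<Longrightarrow> s < k \<Longrightarrow> b \<in> S \<Longrightarrow>
      b \<notin> f ` {..<k} \<Longrightarrow> F (f(s := b)) f = 0"
  shows "F f g = 0"
proof (cases "inj_on f {..<k} \<and> inj_on g {..<k}")
  case False
  then show ?thesis using alt_inv_noninj[OF F] by blast
next
  case True
  then have fi: "inj_on f {..<k}" and gi: "inj_on g {..<k}" by auto
  have cards: "card (f ` {..<k}) = k" "card (g ` {..<k}) = k"
    using fi gi by (simp_all add: card_image)
  have reduce: "F f g = 0" if h: "inj_on h {..<k}" "f ` {..<k} = h ` {..<k}" "F h g = 0" for h
  proof -
    obtain q where q: "q permutes {..<k}" "\<And>i. i \<in> {..<k} \<Longrightarrow> f i = h (q i)"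
      using permutes_of_same_image[OF fi h(1,2)] by blast
    have "F f g = F (h \<circ> q) g"
      by (rule alt_inv_cong[OF F]) (use q in auto)
    also have "\<dots> = 0" using alt_inv_row[OF F q(1)] h(3) by simp
    finally show ?thesis .
  qed
  show ?thesis
  proof (cases "f ` {..<k} \<subseteq> g ` {..<k}")
    case True
    then have "f ` {..<k} = g ` {..<k}"
      using cards by (intro card_subset_eq) auto
    then show ?thesis using reduce[of g] gi g diag by simp
  next
    case False
    then obtain s where s: "s < k" "f s \<notin> g ` {..<k}" by auto
    show ?thesis
    proof (cases "\<exists>t<k. t \<noteq> s \<and> f t \<notin> g ` {..<k}")
      case True
      then obtain t where t: "t < k" "t \<noteq> s" "f t \<notin> g ` {..<k}" by auto
      let ?w = "transpose (f s) (f t)"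
      have w: "?w permutes S"
        using s t f by (intro permutes_swap_id) auto
      have q: "transpose s t permutes {..<k}" using s t by (intro permutes_swap_id) auto
      have "F f g = F (?w \<circ> f) (?w \<circ> g)" by (rule alt_inv_inv[OF F w, symmetric])
      also have "\<dots> = F (f \<circ> transpose s t) g"
      proof (rule alt_inv_cong[OF F])
        fix i assume i: "i < k"
        show "(?w \<circ> f) i = (f \<circ> transpose s t) i"
          using fi i s(1) t(1) by (auto simp: transpose_def inj_on_def)
        show "(?w \<circ> g) i = g i"
          using i s(2) t(3) by (metis comp_apply imageI lessThan_iff transpose_apply_other)
      qed
      also have "\<dots> = - F f g"
        using t by (simp add: alt_inv_row[OF F q] sign_swap_id)
      finally show ?thesis by simp
    next
      case False
      have "f ` {..<k} \<noteq> g ` {..<k}" using s by auto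
      then have "\<not> g ` {..<k} \<subseteq> f ` {..<k}"
        using cards by (metis card_subset_eq finite_imageI finite_lessThan)
      then obtain u where u: "u < k" "g u \<notin> f ` {..<k}" by auto
      \<comment> \<open>Here \<open>f s\<close> is the only entry of \<open>f\<close> missing from
        \<open>g\<close>, so \<open>?h\<close> has the range of \<open>f\<close>. Up to a sign the
        pair is then of the form treated by \<open>adj\<close>.\<close>
      let ?h = "g(u := f s)"
      have hi: "inj_on ?h {..<k}"
        using gi s(2) by (rule inj_on_fun_updI)
      have "f ` {..<k} \<subseteq> ?h ` {..<k}"
      proof
        fix x assume "x \<in> f ` {..<k}"
        then obtain t where t: "t < k" "x = f t" by auto
        show "x \<in> ?h ` {..<k}"
        proof (cases "t = s")
          case True
          then show ?thesis using t u by (auto intro!: image_eqI[of _ _ u])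
        next
          case False
          then have "f t \<in> g ` {..<k}" using \<open>\<not> (\<exists>t<k. t \<noteq> s \<and> f t \<notin> g ` {..<k})\<close> t by auto
          then obtain v where v: "v < k" "f t = g v" by auto
          then have "v \<noteq> u" using u t by (metis imageI lessThan_iff)
          then show ?thesis using v t by (auto intro!: image_eqI[of _ _ v])
        qed
      qed
      moreover have "card (?h ` {..<k}) = k"
        using card_image[OF hi] by (simp only: card_lessThan)
      ultimately have "f ` {..<k} = ?h ` {..<k}"
        by (intro card_subset_eq) (simp_all only: cards finite_imageI finite_lessThan)
      moreover have "F ?h g = 0"
        using adj[OF gi g u(1) _ s(2)] f s(1) by auto
      ultimately show ?thesis using reduce[OF hi] by simp
    qed
  qed
qed

section \<open>The identity and its polarization\<close>

lemma alt_inv_minor_id: "alt_inv k S (minor k id_mat)"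
  unfolding alt_inv_def
proof (intro conjI allI impI)
  fix f g and w :: "'a \<Rightarrow> 'a" assume "w permutes S"
  then have "w a = w b \<longleftrightarrow> a = b" for a b using permutes_inj by (metis injD)
  then show "minor k id_mat (w \<circ> f) (w \<circ> g) = minor k id_mat f g"
    by (simp add: minor_def id_mat_def)
qed (auto simp: minor_row_perm minor_col_perm intro!: minor_cong)

lemma minor_id_zero_row:
  assumes "s < k" "f s \<notin> g ` {..<k}"
  shows "minor k id_mat f g = 0"
  unfolding minor_def
proof (rule sum.neutral, safe)
  fix p assume "p permutes {..<k}"
  then have "p s < k" using assms(1) permutes_in_image by fastforce
  then have "id_mat (f s) (g (p s)) = 0" using assms by (auto simp: id_mat_def)
  then have "(\<Prod>i<k. id_mat (f i) (g (p i))) = 0"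
    using assms(1) by (intro prod_zero) auto
  then show "of_int (sign p) * (\<Prod>i<k. id_mat (f i) (g (p i))) = 0" by simp
qed

lemma minor_id_refl:
  assumes "inj_on f {..<k}"
  shows "minor k id_mat f f = 1"
proof -
  have "(\<Prod>i<k. id_mat (f i) (f (p i))) = (if p = id then 1 else 0)" if p: "p permutes {..<k}" for p
  proof (cases "p = id")
    case False
    then obtain i where i: "p i \<noteq> i" by (auto simp: fun_eq_iff)
    then have "i < k" using p by (metis lessThan_iff permutes_not_in)
    moreover from this have "p i < k" using p permutes_in_image by fastforce
    ultimately have "id_mat (f i) (f (p i)) = 0"
      using assms i by (auto simp: id_mat_def inj_on_def)
    then show ?thesis using \<open>i < k\<close> False by (auto intro!: prod_zero)
  qed (simp add: id_mat_def)
  then have "minor k id_mat f f = (\<Sum>p | p permutes {..<k}. if p = id then 1 else 0)"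
    unfolding minor_def by (intro sum.cong) auto
  also have "\<dots> = 1" by (simp add: finite_permutations permutes_id)
  finally show ?thesis .
qed

lemma minor_id_update:
  assumes f: "inj_on f {..<k}" and s: "s < k"
  shows "minor k id_mat (f(s := b)) f = (if b = f s then 1 else 0)"
proof (cases "b = f s")
  case False
  show ?thesis
  proof (cases "b \<in> f ` {..<k}")
    case True
    then have "\<not> inj_on (f(s := b)) {..<k}"
      using False s by (auto simp: inj_on_def)
    then show ?thesis using False alt_inv_noninj[OF alt_inv_minor_id] by auto
  next
    case b: False
    then show ?thesis using False s minor_id_zero_row[of s k "f(s := b)" f] by simp
  qed
qed (simp add: minor_id_refl[OF f] fun_upd_idem)

lemma polarize_minor_id_refl:
  assumes S: "finite S" and f: "inj_on f {..<k}" "f ` {..<k} \<subseteq> S"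
  shows "polarize k S (minor k id_mat) f f = k"
proof -
  have "polarize k S (minor k id_mat) f f = (\<Sum>s<k. \<Sum>b\<in>S. if b = f s then 1 else 0)"
    unfolding polarize_def by (intro sum.cong refl minor_id_update) (use f in auto)
  also have "\<dots> = (\<Sum>s<k. 1)" using f(2) S by (intro sum.cong) auto
  finally show ?thesis by simp
qed

text \<open>A replacement at a position other than s keeps the foreign value \<open>b\<close> in row
  s, which is then a zero row. At position s only restoring \<open>f s\<close> gives a nonzero
  minor.\<close>

lemma polarize_minor_id_update:
  assumes S: "finite S" and f: "inj_on f {..<k}" "f ` {..<k} \<subseteq> S" and s: "s < k"
    and b: "b \<notin> f ` {..<k}"
  shows "polarize k S (minor k id_mat) (f(s := b)) f = 1"
proof -
  have *: "(\<Sum>c\<in>S. minor k id_mat (f(s := b, t := c)) f) = (if t = s then 1 else 0)"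
    if "t < k" for t
  proof (cases "t = s")
    case True
    then have "(\<Sum>c\<in>S. minor k id_mat (f(s := b, t := c)) f) = (\<Sum>c\<in>S. if c = f s then 1 else 0)"
      using s by (auto intro!: sum.cong minor_id_update[OF f(1)])
    also have "\<dots> = 1" using f(2) S s by auto
    finally show ?thesis using True by simp
  next
    case False
    then have "minor k id_mat (f(s := b, t := c)) f = 0" for c
      using b s by (intro minor_id_zero_row[of s]) auto
    then show ?thesis using False by simp
  qed
  have "polarize k S (minor k id_mat) (f(s := b)) f = (\<Sum>t<k. if t = s then 1 else 0)"
    unfolding polarize_def by (intro sum.cong refl *) auto
  then show ?thesis using s by simp
qed

text \<open>
  The commutant of the symmetric group on \<open>S\<close> in the \<open>k\<close>-th exterior power of the permutation
  module is spanned by the identity and its polarization.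
\<close>

lemma alt_inv_decompose:
  assumes F: "alt_inv k S F" and S: "finite S" and k: "k \<le> card S"
  obtains p q :: real where "\<And>f g. f ` {..<k} \<subseteq> S \<Longrightarrow> g ` {..<k} \<subseteq> S \<Longrightarrow>
    F f g = p * minor k id_mat f g + q * polarize k S (minor k id_mat) f g"
proof -
  have diag: "F f f = F f' f'"
    if f: "inj_on f {..<k}" "f ` {..<k} \<subseteq> S" and f': "inj_on f' {..<k}" "f' ` {..<k} \<subseteq> S" for f f'
  proof -
    obtain w where w: "w permutes S" "\<And>i. i \<in> {..<k} \<Longrightarrow> w (f i) = f' i"
      using permutes_extending[OF S f f'] by blast
    have "F f f = F (w \<circ> f) (w \<circ> f)" by (rule alt_inv_inv[OF F w(1), symmetric])
    also have "\<dots> = F f' f'" by (rule alt_inv_cong[OF F]) (use w(2) in auto)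
    finally show ?thesis .
  qed
  define P where "P = (\<lambda>(f, s, b). inj_on f {..<k} \<and> f ` {..<k} \<subseteq> S \<and> s < k \<and> b \<in> S \<and> b \<notin> f ` {..<k})"
  have adj: "F (f(s := b)) f = F (f'(s' := b')) f'" if P: "P (f, s, b)" "P (f', s', b')" for f s b f' s' b'
  proof -
    let ?q = "transpose s s'"
    \<comment> \<open>With \<open>b\<close> appended as entry k, the pair becomes an injective
      (k+1)-tuple, so a single permutation of \<open>S\<close> moves \<open>f\<close> and
      \<open>b\<close> together. The transposition aligns the positions s and s'; its sign occurs
      twice and cancels.\<close>
    let ?f = "f(k := b)" and ?g = "(f' \<circ> ?q)(k := b')"
    have q: "?q permutes {..<k}" using P by (intro permutes_swap_id) (auto simp: P_def)
    have K: "{..<Suc k} = insert k {..<k}" by auto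
    have im: "(f' \<circ> ?q) ` {..<k} = f' ` {..<k}"
      using permutes_image[OF q] by (metis image_comp)
    have inj: "inj_on (f' \<circ> ?q) {..<k}"
      using P permutes_image[OF q] permutes_inj_on[OF q] by (intro comp_inj_on) (auto simp: P_def)
    have "inj_on ?f {..<Suc k}" "?f ` {..<Suc k} \<subseteq> S"
      using P unfolding K by (auto simp: P_def inj_on_fun_updI image_iff inj_on_def)
    moreover have "?g ` {..<Suc k} \<subseteq> S"
    proof -
      have "?g ` {..<Suc k} = insert b' ((f' \<circ> ?q) ` {..<k})" unfolding K by auto
      then show ?thesis using P unfolding im by (simp add: P_def)
    qed
    moreover have "inj_on ?g {..<Suc k}"
    proof -
      have "b' \<notin> (f' \<circ> ?q) ` {..<k}" using P unfolding im by (simp add: P_def)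
      then show ?thesis using inj unfolding K by (auto simp: inj_on_def)
    qed
    ultimately obtain w where w: "w permutes S" "\<And>i. i \<in> {..<Suc k} \<Longrightarrow> w (?f i) = ?g i"
      using permutes_extending[OF S] by metis
    have wf: "w (f i) = f' (?q i)" if "i < k" for i
      using w(2)[of i] that by simp
    have wb: "w b = b'" using w(2)[of k] by simp
    have "F (f(s := b)) f = F (w \<circ> f(s := b)) (w \<circ> f)" by (rule alt_inv_inv[OF F w(1), symmetric])
    also have "\<dots> = F (f'(s' := b') \<circ> ?q) (f' \<circ> ?q)"
    proof (rule alt_inv_cong[OF F])
      fix i assume i: "i < k"
      show "(w \<circ> f) i = (f' \<circ> ?q) i" using wf i by simp
      show "(w \<circ> f(s := b)) i = (f'(s' := b') \<circ> ?q) i"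
        using wf[OF i] wb by (auto simp: transpose_def)
    qed
    also have "\<dots> = F (f'(s' := b')) f'"
      by (simp add: alt_inv_row[OF F q] alt_inv_col[OF F q] of_int_sign_square)
    finally show ?thesis .
  qed
  obtain f0 where f0: "inj_on f0 {..<k}" "f0 ` {..<k} \<subseteq> S"
    using card_le_inj[of "{..<k}" S] S k by auto
  define \<alpha> where "\<alpha> = F f0 f0"
  \<comment> \<open>If no such triple exists, as for k = 0 or k = card S, any value of \<beta> will
    do.\<close>
  obtain \<beta> where \<beta>: "\<And>f s b. P (f, s, b) \<Longrightarrow> F (f(s := b)) f = \<beta>"
  proof (cases "\<exists>f s b. P (f, s, b)")
    case True
    then obtain f s b where "P (f, s, b)" by blast
    then show ?thesis using that[of "F (f(s := b)) f"] adj by blast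
  qed (use that in blast)
  \<comment> \<open>The identity takes the value 1 on the diagonal and 0 on neighbouring pairs, its
    polarization k and 1. Solving for the values \<alpha> and \<beta> of \<open>F\<close> gives
    these coefficients.\<close>
  let ?G = "\<lambda>f g. F f g - (\<alpha> - k * \<beta>) * minor k id_mat f g"
  let ?H = "\<lambda>f g. ?G f g - \<beta> * polarize k S (minor k id_mat) f g"
  have "?H f g = 0" if fg: "f ` {..<k} \<subseteq> S" "g ` {..<k} \<subseteq> S" for f g
  proof (rule alt_inv_eq_0[where F = ?H, OF _ fg])
    show "alt_inv k S ?H"
      by (intro alt_inv_diff alt_inv_scale alt_inv_polarize alt_inv_minor_id F)
  next
    fix f assume f: "inj_on f {..<k}" "f ` {..<k} \<subseteq> S"
    then show "?H f f = 0"
      using diag[OF f f0] by (simp add: \<alpha>_def minor_id_refl polarize_minor_id_refl[OF S])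
  next
    fix f s b assume f: "inj_on f {..<k}" "f ` {..<k} \<subseteq> S" "s < k" "b \<in> S" "b \<notin> f ` {..<k}"
    then have "F (f(s := b)) f = \<beta>" by (intro \<beta>) (simp add: P_def)
    moreover have "b \<noteq> f s" using f by auto
    ultimately show "?H (f(s := b)) f = 0"
      using f by (simp add: minor_id_update polarize_minor_id_update[OF S])
  qed
  then show ?thesis
    by (intro that[of "\<alpha> - k * \<beta>" \<beta>]) (simp add: algebra_simps)
qed

section \<open>Traces of alternating invariant forms\<close>

lemma tuples_image: "f \<in> tuples k S \<Longrightarrow> f ` {..<k} \<subseteq> S"
  by (auto simp: tuples_def)

lemma card_inj_tuples:
  assumes "finite S" "k \<le> card S"
  shows "card {f \<in> tuples k S. inj_on f {..<k}} = fact k * (card S choose k)"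
proof -
  have "prod ((-) m) {0..<k} = fact k * (m choose k)" if "k \<le> m" for m
    using that
  proof (induction k)
    case (Suc k)
    have "Suc k * (m choose Suc k) = (m - k) * (m choose k)"
      using binomial_absorption[of k m] binomial_absorb_comp[of m k] by simp
    then have "fact (Suc k) * (m choose Suc k) = fact k * ((m - k) * (m choose k))"
      by (simp only: fact_Suc of_nat_id mult_ac)
    then show ?case using Suc by simp
  qed simp
  then show ?thesis
    using assms card_inj_on_subset_funcset[of "{..<k}" S "{..<k}"] by (simp add: tuples_def)
qed

lemma sum_tuples_inj:
  assumes "finite S" "k \<le> card S"
    and "\<And>f. f \<in> tuples k S \<Longrightarrow> inj_on f {..<k} \<Longrightarrow> h f = c"
    and "\<And>f. f \<in> tuples k S \<Longrightarrow> \<not> inj_on f {..<k} \<Longrightarrow> h f = 0"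
  shows "(\<Sum>f\<in>tuples k S. h f) = fact k * real (card S choose k) * c"
proof -
  have "(\<Sum>f\<in>tuples k S. h f) = (\<Sum>f\<in>{f \<in> tuples k S. inj_on f {..<k}}. c)"
    using assms by (intro sum.mono_neutral_cong_right) auto
  also have "\<dots> = real (card {f \<in> tuples k S. inj_on f {..<k}}) * c" by simp
  finally show ?thesis using card_inj_tuples[OF assms(1,2)] by simp
qed

lemma alt_inv_traces:
  fixes p q :: real
  assumes F: "alt_inv k S F" and S: "finite S" and k: "k \<le> card S"
    and dec: "\<And>f g. f ` {..<k} \<subseteq> S \<Longrightarrow> g ` {..<k} \<subseteq> S \<Longrightarrow>
      F f g = p * minor k id_mat f g + q * polarize k S (minor k id_mat) f g"
  shows "(\<Sum>f\<in>tuples k S. F f f) = fact k * real (card S choose k) * (p + k * q)"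
    and "(\<Sum>f\<in>tuples k S. polarize k S F f f) = fact k * real (card S choose k) * (k * (p + card S * q))"
proof -
  have diag: "F f f = p + k * q" if "f \<in> tuples k S" "inj_on f {..<k}" for f
    using dec[of f f] that by (simp add: tuples_image minor_id_refl polarize_minor_id_refl[OF S])
  show "(\<Sum>f\<in>tuples k S. F f f) = fact k * real (card S choose k) * (p + k * q)"
    by (rule sum_tuples_inj[OF S k diag alt_inv_noninj[OF F]]) auto
  show "(\<Sum>f\<in>tuples k S. polarize k S F f f) = fact k * real (card S choose k) * (k * (p + card S * q))"
  proof (rule sum_tuples_inj[OF S k])
    fix f assume f: "f \<in> tuples k S" "inj_on f {..<k}"
    have card: "card (S - f ` {..<k}) = card S - k"
      using f S tuples_image[OF f(1)] by (simp add: card_Diff_subset card_image)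
    \<comment> \<open>The old entry \<open>f s\<close> contributes the diagonal value p + k q, the
      other entries of \<open>f\<close> contribute 0 by repetition, and each of the card S - k
      remaining values contributes q.\<close>
    have "(\<Sum>b\<in>S. F (f(s := b)) f) = p + card S * q" if s: "s < k" for s
    proof -
      have fs: "f s \<in> S" using tuples_image[OF f(1)] s by auto
      have val: "F (f(s := b)) f = (if b = f s then p + k * q else 0) + (if b \<in> S - f ` {..<k} then q else 0)"
        if b: "b \<in> S" for b
      proof -
        consider "b = f s" | "b \<in> f ` {..<k}" "b \<noteq> f s" | "b \<notin> f ` {..<k}" by blast
        then show ?thesis
        proof cases
          case 1
          then show ?thesis using diag[OF f] s by (simp add: fun_upd_idem)
        next
          case 2
          then have "\<not> inj_on (f(s := b)) {..<k}" using s by (auto simp: inj_on_def)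
          then show ?thesis using 2 alt_inv_noninj[OF F] by auto
        next
          case 3
          have "f(s := b) ` {..<k} \<subseteq> S" using tuples_image[OF f(1)] b by auto
          moreover have "b \<noteq> f s" using 3 s by auto
          ultimately show ?thesis
            using 3 b s f dec[of "f(s := b)" f] tuples_image[OF f(1)]
            by (simp add: minor_id_update polarize_minor_id_update[OF S])
        qed
      qed
      have "(\<Sum>b\<in>S. F (f(s := b)) f) = (\<Sum>b\<in>S. (if b = f s then p + k * q else 0)) +
          (\<Sum>b\<in>S. (if b \<in> S - f ` {..<k} then q else 0))"
        unfolding sum.distrib[symmetric] by (rule sum.cong[OF refl val])
      moreover have "(\<Sum>b\<in>S. (if b \<in> S - f ` {..<k} then q else 0)) = card (S - f ` {..<k}) * q"
        using S by (subst sum.inter_restrict[symmetric]) (auto simp: Int_absorb1)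
      ultimately show ?thesis
        using fs S k by (simp add: card of_nat_diff algebra_simps)
    qed
    then show "polarize k S F f f = k * (p + card S * q)"
      by (simp add: polarize_def)
  next
    fix f :: "nat \<Rightarrow> 'a" assume "\<not> inj_on f {..<k}"
    then show "polarize k S F f f = 0"
      using alt_inv_noninj[OF F] by (simp add: polarize_def)
  qed
qed

text \<open>The double sum is (k!)^2 times the trace of a product of operators. Expanding only
  \<open>F\<close> reduces it to the two traces of \<open>G\<close>.\<close>

lemma alt_inv_pairing:
  fixes p q :: real
  assumes G: "alt_inv k S G" and S: "finite S"
    and dec: "\<And>f g. f ` {..<k} \<subseteq> S \<Longrightarrow> g ` {..<k} \<subseteq> S \<Longrightarrow>
      F f g = p * minor k id_mat f g + q * polarize k S (minor k id_mat) f g"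
  shows "(\<Sum>f\<in>tuples k S. \<Sum>g\<in>tuples k S. F f g * G g f) =
    fact k * (p * (\<Sum>f\<in>tuples k S. G f f) + q * (\<Sum>f\<in>tuples k S. polarize k S G f f))"
proof -
  have id: "(\<Sum>g\<in>tuples k S. minor k id_mat f g * G g h) = fact k * G f h" if "f ` {..<k} \<subseteq> S" for f h
    using that by (intro sum_tuples_minor_id[OF S]) (auto simp: alt_inv_row[OF G] intro: alt_inv_cong[OF G])
  have "(\<Sum>g\<in>tuples k S. F f g * G g f) = fact k * (p * G f f + q * polarize k S G f f)"
    if f: "f \<in> tuples k S" for f
  proof -
    have "(\<Sum>g\<in>tuples k S. F f g * G g f) =
        p * (\<Sum>g\<in>tuples k S. minor k id_mat f g * G g f) +
        q * (\<Sum>g\<in>tuples k S. polarize k S (minor k id_mat) f g * G g f)"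
      using dec[OF tuples_image[OF f] tuples_image]
      by (simp add: sum_distrib_left sum.distrib algebra_simps)
    also have "(\<Sum>g\<in>tuples k S. polarize k S (minor k id_mat) f g * G g f) =
        (\<Sum>s<k. \<Sum>b\<in>S. \<Sum>g\<in>tuples k S. minor k id_mat (f(s := b)) g * G g f)"
    proof -
      have "(\<Sum>g\<in>tuples k S. polarize k S (minor k id_mat) f g * G g f) =
        (\<Sum>g\<in>tuples k S. \<Sum>s<k. \<Sum>b\<in>S. minor k id_mat (f(s := b)) g * G g f)"
        by (simp add: polarize_def sum_distrib_right)
      also have "\<dots> = (\<Sum>s<k. \<Sum>g\<in>tuples k S. \<Sum>b\<in>S. minor k id_mat (f(s := b)) g * G g f)"
        by (rule sum.swap)
      also have "\<dots> = (\<Sum>s<k. \<Sum>b\<in>S. \<Sum>g\<in>tuples k S. minor k id_mat (f(s := b)) g * G g f)"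
        by (rule sum.cong[OF refl], rule sum.swap)
      finally show ?thesis .
    qed
    also have "\<dots> = (\<Sum>s<k. \<Sum>b\<in>S. fact k * G (f(s := b)) f)"
      by (intro sum.cong refl id) (use tuples_image[OF f] in auto)
    also have "\<dots> = fact k * polarize k S G f f"
      by (simp add: polarize_def sum_distrib_left)
    finally show ?thesis using id[OF tuples_image[OF f]] by (simp add: algebra_simps)
  qed
  then show ?thesis
    by (simp add: sum_distrib_left sum.distrib algebra_simps)
qed

text \<open>For an alternating form this is the trace on the exterior power: tuples with repetitions
  contribute 0 and every k-subset is listed k! times.\<close>

definition tr_form :: "nat \<Rightarrow> 'a set \<Rightarrow> ((nat \<Rightarrow> 'a) \<Rightarrow> (nat \<Rightarrow> 'a) \<Rightarrow> real) \<Rightarrow> real" where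
  "tr_form k S F = (\<Sum>f\<in>tuples k S. F f f) / fact k"

text \<open>Let m = card S. The operator with coefficients p and q is the scalar p on a summand of
  dimension binom(m-1, k) and p + m q on one of dimension binom(m-1, k-1); \<open>u\<close> and
  \<open>v\<close> are the traces on these. For k = m the first summand is 0, and so are
  \<open>u\<close> and, by the convention on division by 0, the quotient.\<close>

lemma alt_inv_trace_product:
  assumes F: "alt_inv k S F" and G: "alt_inv k S G" and S: "finite S" "S \<noteq> {}" and k: "k \<le> card S"
  defines "v \<equiv> \<lambda>F. tr_form k S (polarize k S F) / card S"
  defines "u \<equiv> \<lambda>F. tr_form k S F - v F"
  shows "(\<Sum>f\<in>tuples k S. \<Sum>g\<in>tuples k S. F f g * G g f) / (fact k)\<^sup>2 =
    u F * u G / real ((card S - 1) choose k) +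
    (if k = 0 then 0 else v F * v G / real ((card S - 1) choose (k - 1)))"
proof -
  let ?m = "card S"
  have m: "?m > 0" using S by (simp add: card_gt_0_iff)
  have uv: "u H = real ((?m - 1) choose k) * p \<and>
      v H = (if k = 0 then 0 else real ((?m - 1) choose (k - 1)) * (p + ?m * q))"
    if H: "alt_inv k S H" and dec: "\<And>f g. f ` {..<k} \<subseteq> S \<Longrightarrow> g ` {..<k} \<subseteq> S \<Longrightarrow>
      H f g = p * minor k id_mat f g + q * polarize k S (minor k id_mat) f g" for H and p q :: real
  proof -
    have t: "tr_form k S H = real (?m choose k) * (p + k * q)"
      using alt_inv_traces(1)[OF H S(1) k dec] by (simp add: tr_form_def)
    have v: "v H = real (?m choose k) * (k * (p + ?m * q)) / ?m"
      using alt_inv_traces(2)[OF H S(1) k dec] by (simp add: tr_form_def v_def)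
    have c1: "real (?m - k) * real (?m choose k) = ?m * real ((?m - 1) choose k)"
      using binomial_absorb_comp[of ?m k] by (metis of_nat_mult)
    have "u H = real (?m - k) * real (?m choose k) * p / ?m"
      using m k unfolding u_def t v by (simp add: field_simps of_nat_diff)
    also have "\<dots> = real ((?m - 1) choose k) * p" unfolding c1 using m by simp
    finally have u: "u H = real ((?m - 1) choose k) * p" .
    have "v H = real ((?m - 1) choose (k - 1)) * (p + ?m * q)" if "k \<noteq> 0"
    proof -
      have "k * (?m choose k) = ?m * ((?m - 1) choose (k - 1))"
        using binomial_absorption[of "k - 1" ?m] that by simp
      then have "real k * real (?m choose k) = ?m * real ((?m - 1) choose (k - 1))"
        by (metis of_nat_mult)
      then have "v H = ?m * real ((?m - 1) choose (k - 1)) * (p + ?m * q) / ?m"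
        unfolding v by (simp only: mult.assoc[symmetric] mult.commute[of "real (?m choose k)" "real k"])
      then show ?thesis using m by simp
    qed
    then show ?thesis using u v by auto
  qed
  obtain p q where dF: "\<And>f g. f ` {..<k} \<subseteq> S \<Longrightarrow> g ` {..<k} \<subseteq> S \<Longrightarrow>
    F f g = p * minor k id_mat f g + q * polarize k S (minor k id_mat) f g"
    using alt_inv_decompose[OF F S(1) k] by blast
  obtain p' q' where dG: "\<And>f g. f ` {..<k} \<subseteq> S \<Longrightarrow> g ` {..<k} \<subseteq> S \<Longrightarrow>
    G f g = p' * minor k id_mat f g + q' * polarize k S (minor k id_mat) f g"
    using alt_inv_decompose[OF G S(1) k] by blast
  have "(\<Sum>f\<in>tuples k S. \<Sum>g\<in>tuples k S. F f g * G g f) / (fact k)\<^sup>2 =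
      p * tr_form k S G + q * tr_form k S (polarize k S G)"
    using alt_inv_pairing[where F = F and p = p and q = q, OF G S(1) dF]
    by (simp add: tr_form_def power2_eq_square field_simps)
  also have "\<dots> = p * u G + (p + ?m * q) * v G"
    using m by (simp add: u_def v_def field_simps)
  also have "\<dots> = u F * u G / real ((?m - 1) choose k) +
    (if k = 0 then 0 else v F * v G / real ((?m - 1) choose (k - 1)))"
    using uv[OF F dF] uv[OF G dG] by (auto simp: binomial_eq_0)
  finally show ?thesis .
qed

section \<open>Partial traces of exterior powers\<close>

text \<open>
  The partial trace \<open>partial_minor\<close> is, up to sign, the matrix produced by the Faddeev-LeVerrier
  algorithm: it satisfies \<open>B (k + 1) = E (k + 1) * M - M * B k\<close>, where \<open>E k\<close> is the trace of the
  \<open>k\<close>-th exterior power of \<open>M\<close>.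
\<close>

definition partial_minor :: "nat \<Rightarrow> 'a set \<Rightarrow> ('a \<Rightarrow> 'a \<Rightarrow> real) \<Rightarrow> 'a \<Rightarrow> 'a \<Rightarrow> real" where
  "partial_minor k S M a b = (\<Sum>f\<in>tuples k S. minor (Suc k) M (f(k := a)) (f(k := b))) / fact k"

lemma tuples_0 [simp]: "tuples 0 S = {\<lambda>_. undefined}"
  by (simp add: tuples_def)

lemma partial_minor_0: "partial_minor 0 S M a b = M a b"
  by (simp add: partial_minor_def minor_Suc)

lemma minor_row_col_perm:
  assumes "q permutes {..<k}"
  shows "minor k M (f \<circ> q) (g \<circ> q) = minor k M f g"
  by (simp add: minor_row_perm[OF assms] minor_col_perm[OF assms] of_int_sign_square)

lemma fun_upd_comp_transpose: "(f \<circ> transpose s t)(s := b) = f(t := b) \<circ> transpose s t"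
  by (auto simp: fun_eq_iff transpose_def)

text \<open>Expansion along the added row. The k + 1 correction terms are equal, since exchanging
  slots j and k in rows and columns does not change a minor; the sum over the last slot then forms
  the matrix product.\<close>

lemma partial_minor_Suc:
  assumes S: "finite S"
  shows "partial_minor (Suc k) S M a b =
    tr_form (Suc k) S (minor (Suc k) M) * M a b - (\<Sum>c\<in>S. M a c * partial_minor k S M c b)"
proof -
  let ?K = "Suc k"
  have expand: "minor (Suc ?K) M (f(?K := a)) (f(?K := b)) =
      M a b * minor ?K M f f - (\<Sum>j<?K. M a (f j) * minor ?K M f (f(j := b)))" for f
  proof -
    have "minor ?K M (f(?K := a)) (f(?K := b)) = minor ?K M f f"
      by (rule minor_cong) auto
    moreover have "minor ?K M (f(?K := a)) (f(?K := b, j := b)) = minor ?K M f (f(j := b))" for j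
      by (rule minor_cong) auto
    ultimately show ?thesis
      by (subst minor_Suc) simp
  qed
  have swap: "(\<Sum>f\<in>tuples ?K S. M a (f j) * minor ?K M f (f(j := b))) =
      fact k * (\<Sum>c\<in>S. M a c * partial_minor k S M c b)" if "j < ?K" for j
  proof -
    let ?q = "transpose j k"
    have q: "?q permutes {..<?K}" using that by (intro permutes_swap_id) auto
    have "(\<Sum>f\<in>tuples ?K S. M a (f j) * minor ?K M f (f(j := b))) =
        (\<Sum>f\<in>tuples ?K S. M a ((f \<circ> ?q) j) * minor ?K M (f \<circ> ?q) ((f \<circ> ?q)(j := b)))"
      by (rule sum_tuples_perm[OF q, symmetric])
    also have "\<dots> = (\<Sum>f\<in>tuples ?K S. M a (f k) * minor ?K M f (f(k := b)))"
      by (simp add: fun_upd_comp_transpose minor_row_col_perm[OF q])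
    also have "\<dots> = (\<Sum>f\<in>tuples k S. \<Sum>c\<in>S. M a c * minor ?K M (f(k := c)) (f(k := b)))"
      by (simp add: sum_tuples_Suc[OF S])
    also have "\<dots> = (\<Sum>c\<in>S. \<Sum>f\<in>tuples k S. M a c * minor ?K M (f(k := c)) (f(k := b)))"
      by (rule sum.swap)
    also have "\<dots> = fact k * (\<Sum>c\<in>S. M a c * partial_minor k S M c b)"
      by (simp add: partial_minor_def sum_distrib_left sum_divide_distrib)
    finally show ?thesis .
  qed
  have "(\<Sum>f\<in>tuples ?K S. minor (Suc ?K) M (f(?K := a)) (f(?K := b))) =
      M a b * (\<Sum>f\<in>tuples ?K S. minor ?K M f f) -
      (\<Sum>f\<in>tuples ?K S. \<Sum>j<?K. M a (f j) * minor ?K M f (f(j := b)))"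
    unfolding expand by (simp only: sum_subtractf sum_distrib_left)
  also have "(\<Sum>f\<in>tuples ?K S. \<Sum>j<?K. M a (f j) * minor ?K M f (f(j := b))) =
      (\<Sum>j<?K. \<Sum>f\<in>tuples ?K S. M a (f j) * minor ?K M f (f(j := b)))"
    by (rule sum.swap)
  also have "\<dots> = (\<Sum>j<?K. fact k * (\<Sum>c\<in>S. M a c * partial_minor k S M c b))"
    by (rule sum.cong[OF refl swap]) simp
  also have "\<dots> = fact ?K * (\<Sum>c\<in>S. M a c * partial_minor k S M c b)"
    by (simp add: algebra_simps)
  finally show ?thesis
    unfolding partial_minor_def[of ?K] tr_form_def by (simp only: diff_divide_distrib) simp
qed

lemma tr_form_minor_Suc:
  assumes S: "finite S"
  shows "real (Suc k) * tr_form (Suc k) S (minor (Suc k) M) = (\<Sum>a\<in>S. partial_minor k S M a a)"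
proof -
  have "(\<Sum>f\<in>tuples (Suc k) S. minor (Suc k) M f f) =
      (\<Sum>a\<in>S. \<Sum>f\<in>tuples k S. minor (Suc k) M (f(k := a)) (f(k := a)))"
    unfolding sum_tuples_Suc[OF S] by (rule sum.swap)
  then show ?thesis
    by (simp add: tr_form_def partial_minor_def sum_divide_distrib[symmetric] field_simps del: of_nat_Suc)
qed

text \<open>After a relabelling the replaced slot is the last one, so the k + 1 slots contribute
  equally. The ordinary trace sums the diagonal of the partial trace; the trace against the
  derivation sums all its entries.\<close>

lemma tr_form_polarize_minor_Suc:
  assumes S: "finite S"
  shows "tr_form (Suc k) S (polarize (Suc k) S (minor (Suc k) M)) =
    (\<Sum>a\<in>S. \<Sum>b\<in>S. partial_minor k S M a b)"
proof -
  let ?K = "Suc k"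
  let ?B = "\<lambda>a b. \<Sum>f\<in>tuples k S. minor (Suc k) M (f(k := a)) (f(k := b))"
  have swap: "(\<Sum>f\<in>tuples ?K S. \<Sum>b\<in>S. minor ?K M (f(s := b)) f) = (\<Sum>a\<in>S. \<Sum>b\<in>S. ?B a b)"
    if "s < ?K" for s
  proof -
    let ?q = "transpose s k"
    have q: "?q permutes {..<?K}" using that by (intro permutes_swap_id) auto
    have "(\<Sum>f\<in>tuples ?K S. \<Sum>b\<in>S. minor ?K M (f(s := b)) f) =
        (\<Sum>f\<in>tuples ?K S. \<Sum>b\<in>S. minor ?K M ((f \<circ> ?q)(s := b)) (f \<circ> ?q))"
      by (rule sum_tuples_perm[OF q, symmetric])
    also have "\<dots> = (\<Sum>f\<in>tuples ?K S. \<Sum>b\<in>S. minor ?K M (f(k := b)) f)"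
      by (simp add: fun_upd_comp_transpose minor_row_col_perm[OF q])
    also have "\<dots> = (\<Sum>f\<in>tuples k S. \<Sum>b\<in>S. \<Sum>a\<in>S. minor ?K M (f(k := a)) (f(k := b)))"
      by (simp add: sum_tuples_Suc[OF S])
    also have "\<dots> = (\<Sum>f\<in>tuples k S. \<Sum>a\<in>S. \<Sum>b\<in>S. minor ?K M (f(k := a)) (f(k := b)))"
      by (rule sum.cong[OF refl], rule sum.swap)
    also have "\<dots> = (\<Sum>a\<in>S. \<Sum>f\<in>tuples k S. \<Sum>b\<in>S. minor ?K M (f(k := a)) (f(k := b)))"
      by (rule sum.swap)
    also have "\<dots> = (\<Sum>a\<in>S. \<Sum>b\<in>S. ?B a b)"
      by (rule sum.cong[OF refl], rule sum.swap)
    finally show ?thesis .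
  qed
  have "(\<Sum>f\<in>tuples ?K S. polarize ?K S (minor ?K M) f f) =
      (\<Sum>s<?K. \<Sum>f\<in>tuples ?K S. \<Sum>b\<in>S. minor ?K M (f(s := b)) f)"
    unfolding polarize_def by (rule sum.swap)
  also have "\<dots> = (\<Sum>s<?K. \<Sum>a\<in>S. \<Sum>b\<in>S. ?B a b)"
    by (rule sum.cong[OF refl swap]) simp
  also have "\<dots> = real ?K * (\<Sum>a\<in>S. \<Sum>b\<in>S. ?B a b)"
    by simp
  finally show ?thesis
    by (simp add: tr_form_def partial_minor_def sum_divide_distrib[symmetric] field_simps del: of_nat_Suc)
qed

text \<open>The recursion unrolled. The matrix powers enter as a family \<open>P\<close> with a
  product rule on \<open>S\<close> only, so that \<open>std_rep n (s ^^ r)\<close> can be inserted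
  directly.\<close>

lemma partial_minor_powers:
  assumes S: "finite S"
    and P: "\<And>r a b. a \<in> S \<Longrightarrow> b \<in> S \<Longrightarrow> P (Suc (Suc r)) a b = (\<Sum>c\<in>S. P (Suc 0) a c * P (Suc r) c b)"
    and "a \<in> S" "b \<in> S"
  shows "partial_minor k S (P (Suc 0)) a b =
    (\<Sum>r\<le>k. (- 1) ^ r * tr_form (k - r) S (minor (k - r) (P (Suc 0))) * P (Suc r) a b)"
  using assms(3,4)
proof (induction k arbitrary: a b)
  case 0
  then show ?case by (simp add: partial_minor_0 tr_form_def)
next
  case (Suc k)
  let ?E = "\<lambda>k. tr_form k S (minor k (P (Suc 0)))"
  have "(\<Sum>c\<in>S. P (Suc 0) a c * partial_minor k S (P (Suc 0)) c b) =
      (\<Sum>c\<in>S. \<Sum>r\<le>k. P (Suc 0) a c * ((- 1) ^ r * ?E (k - r) * P (Suc r) c b))"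
    using Suc by (simp add: sum_distrib_left)
  also have "\<dots> = (\<Sum>r\<le>k. \<Sum>c\<in>S. P (Suc 0) a c * ((- 1) ^ r * ?E (k - r) * P (Suc r) c b))"
    by (rule sum.swap)
  also have "\<dots> = (\<Sum>r\<le>k. (- 1) ^ r * ?E (k - r) * P (Suc (Suc r)) a b)"
    using Suc.prems by (simp add: P sum_distrib_left mult_ac)
  finally show ?case
    unfolding partial_minor_Suc[OF S]
    by (subst sum.atMost_Suc_shift) (simp add: sum_negf)
qed

section \<open>The standard representation\<close>

text \<open>
  The matrix of \<open>s\<close> on the standard representation, in the basis \<open>e\<^sub>a - e\<^sub>n\<close> with \<open>1 \<le> a < n\<close>,
  which the stabilizer of \<open>n\<close> permutes. The column of index \<open>n\<close> vanishes, so sums over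
  \<open>{1..<n}\<close> may be extended to \<open>{1..n}\<close>.
\<close>

definition std_rep :: "nat \<Rightarrow> (nat \<Rightarrow> nat) \<Rightarrow> nat \<Rightarrow> nat \<Rightarrow> real" where
  "std_rep n s a b = of_bool (a = s b) - of_bool (a = s n)"

lemma sum_upto_n:
  fixes h :: "nat \<Rightarrow> real"
  assumes "n \<ge> 1" "h n = 0"
  shows "(\<Sum>a\<in>{1..<n}. h a) = (\<Sum>a\<in>{1..n}. h a)"
proof -
  have "{1..n} = insert n {1..<n}" using assms by auto
  then show ?thesis using assms by simp
qed

lemma std_rep_n [simp]: "std_rep n s a n = 0"
  by (simp add: std_rep_def)

lemma std_rep_comp:
  assumes n: "n \<ge> 1" and t: "t permutes {1..n}" and b: "b \<in> {1..<n}"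
  shows "(\<Sum>c\<in>{1..<n}. std_rep n s a c * std_rep n t c b) = std_rep n (s \<circ> t) a b"
proof -
  have tb: "t b \<in> {1..n}" "t n \<in> {1..n}"
    using permutes_in_image[OF t, of b] permutes_in_image[OF t, of n] b n by auto
  have sum1: "(\<Sum>c\<in>{1..n}. std_rep n s a c * of_bool (c = d)) = std_rep n s a d" if "d \<in> {1..n}" for d
  proof -
    have "(\<Sum>c\<in>{1..n}. std_rep n s a c * of_bool (c = d)) = (\<Sum>c\<in>{1..n}. if c = d then std_rep n s a c else 0)"
      by (intro sum.cong) auto
    then show ?thesis using that by simp
  qed
  have "(\<Sum>c\<in>{1..<n}. std_rep n s a c * std_rep n t c b) = (\<Sum>c\<in>{1..n}. std_rep n s a c * std_rep n t c b)"
    by (rule sum_upto_n[OF n]) simp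
  also have "\<dots> = (\<Sum>c\<in>{1..n}. std_rep n s a c * of_bool (c = t b))
      - (\<Sum>c\<in>{1..n}. std_rep n s a c * of_bool (c = t n))"
    unfolding std_rep_def[of n t] by (simp only: right_diff_distrib sum_subtractf)
  also have "\<dots> = std_rep n s a (t b) - std_rep n s a (t n)"
    unfolding sum1[OF tb(1)] sum1[OF tb(2)] ..
  finally show ?thesis by (simp add: std_rep_def)
qed

lemma sum_of_bool_eq:
  assumes "finite A"
  shows "(\<Sum>a\<in>A. of_bool (a = d)) = (of_bool (d \<in> A) :: real)"
proof -
  have "(\<Sum>a\<in>A. of_bool (a = d)) = (\<Sum>a\<in>A. if a = d then 1 else (0 :: real))"
    by (intro sum.cong) auto
  then show ?thesis using assms by simp
qed

lemma std_rep_trace: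
  assumes n: "n \<ge> 1" and s: "s permutes {1..n}"
  shows "(\<Sum>a\<in>{1..<n}. std_rep n s a a) = real (card {a \<in> {1..n}. s a = a}) - 1"
proof -
  have sn: "s n \<in> {1..n}" using permutes_in_image[OF s, of n] n by auto
  have "(\<Sum>a\<in>{1..<n}. std_rep n s a a) = (\<Sum>a\<in>{1..n}. std_rep n s a a)"
    by (rule sum_upto_n[OF n]) simp
  also have "\<dots> = (\<Sum>a\<in>{1..n}. of_bool (s a = a)) - (\<Sum>a\<in>{1..n}. of_bool (a = s n))"
    unfolding sum_subtractf[symmetric] by (rule sum.cong) (auto simp: std_rep_def)
  also have "(\<Sum>a\<in>{1..n}. of_bool (s a = a)) = real (card {a \<in> {1..n}. s a = a})"
    by (simp add: of_bool_def sum.inter_filter[symmetric])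
  finally show ?thesis using sn by (simp only: sum_of_bool_eq[OF finite_atLeastAtMost]) simp
qed

text \<open>Applied to the powers of a permutation, this detects when n returns to itself. It is
  here that the length of the marked cycle enters.\<close>

lemma std_rep_total:
  assumes n: "n \<ge> 1" and s: "s permutes {1..n}"
  shows "(\<Sum>a\<in>{1..<n}. \<Sum>b\<in>{1..<n}. std_rep n s a b) = real n * of_bool (s n = n) - 1"
proof -
  have col: "(\<Sum>a\<in>{1..<n}. of_bool (a = s b)) = 1 - (of_bool (s b = n) :: real)" if "b \<in> {1..n}" for b
  proof -
    have "s b \<in> {1..n}" using permutes_in_image[OF s, of b] that by simp
    then show ?thesis by (subst sum_of_bool_eq) auto
  qed
  have nn: "n \<in> {1..n}" using n by simp
  have "(\<Sum>a\<in>{1..<n}. \<Sum>b\<in>{1..<n}. std_rep n s a b) = (\<Sum>b\<in>{1..<n}. \<Sum>a\<in>{1..<n}. std_rep n s a b)"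
    by (rule sum.swap)
  also have "\<dots> = (\<Sum>b\<in>{1..n}. \<Sum>a\<in>{1..<n}. std_rep n s a b)"
    by (rule sum_upto_n[OF n]) simp
  also have "\<dots> = (\<Sum>b\<in>{1..n}. of_bool (s n = n) - of_bool (s b = n))"
  proof (rule sum.cong[OF refl])
    fix b assume b: "b \<in> {1..n}"
    show "(\<Sum>a\<in>{1..<n}. std_rep n s a b) = of_bool (s n = n) - of_bool (s b = n)"
      unfolding std_rep_def sum_subtractf col[OF nn] col[OF b] by simp
  qed
  also have "\<dots> = real n * of_bool (s n = n) - (\<Sum>b\<in>{1..n}. of_bool (b = inv s n))"
  proof -
    have "s b = n \<longleftrightarrow> b = inv s n" for b using permutes_inv_eq[OF s, of n b] by auto
    then show ?thesis by (simp add: sum_subtractf)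
  qed
  also have "(\<Sum>b\<in>{1..n}. of_bool (b = inv s n)) = (1 :: real)"
    using permutes_in_image[OF permutes_inv[OF s], of n] nn by (subst sum_of_bool_eq) auto
  finally show ?thesis .
qed

lemma std_rep_powers:
  assumes n: "n \<ge> 1" and s: "s permutes {1..n}" and a: "a \<in> {1..<n}" "b \<in> {1..<n}"
  shows "std_rep n (s ^^ Suc (Suc r)) a b =
    (\<Sum>c\<in>{1..<n}. std_rep n (s ^^ Suc 0) a c * std_rep n (s ^^ Suc r) c b)"
proof -
  have "s ^^ Suc r permutes {1..n}" using s by (rule permutes_funpow)
  then show ?thesis using std_rep_comp[OF n _ a(2), of "s ^^ Suc r" s a] by simp
qed

section \<open>Newton identities for the two traces\<close>

definition ext_trace :: "nat \<Rightarrow> (nat \<Rightarrow> nat) \<Rightarrow> nat \<Rightarrow> real" where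
  "ext_trace n s k = tr_form k {1..<n} (minor k (std_rep n s))"

definition pol_trace :: "nat \<Rightarrow> (nat \<Rightarrow> nat) \<Rightarrow> nat \<Rightarrow> real" where
  "pol_trace n s k = tr_form k {1..<n} (polarize k {1..<n} (minor k (std_rep n s)))"

text \<open>Newton's identity between elementary symmetric functions and power sums of the
  eigenvalues of \<open>s\<close> on V.\<close>

lemma ext_trace_Suc:
  assumes n: "n \<ge> 1" and s: "s permutes {1..n}"
  shows "real (Suc k) * ext_trace n s (Suc k) =
    (\<Sum>r\<le>k. (- 1) ^ r * (real (card {a \<in> {1..n}. (s ^^ Suc r) a = a}) - 1) * ext_trace n s (k - r))"
proof -
  have "real (Suc k) * ext_trace n s (Suc k) = (\<Sum>a\<in>{1..<n}. partial_minor k {1..<n} (std_rep n s) a a)"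
    unfolding ext_trace_def by (rule tr_form_minor_Suc) simp
  also have "\<dots> = (\<Sum>a\<in>{1..<n}. \<Sum>r\<le>k. (- 1) ^ r * ext_trace n s (k - r) * std_rep n (s ^^ Suc r) a a)"
    using partial_minor_powers[of "{1..<n}" "\<lambda>r. std_rep n (s ^^ r)", OF _ std_rep_powers[OF n s]]
    by (simp add: ext_trace_def)
  also have "\<dots> = (\<Sum>r\<le>k. \<Sum>a\<in>{1..<n}. (- 1) ^ r * ext_trace n s (k - r) * std_rep n (s ^^ Suc r) a a)"
    by (rule sum.swap)
  also have "\<dots> = (\<Sum>r\<le>k. (- 1) ^ r * ext_trace n s (k - r) * (\<Sum>a\<in>{1..<n}. std_rep n (s ^^ Suc r) a a))"
    by (simp only: sum_distrib_left)
  finally show ?thesis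
    unfolding std_rep_trace[OF n permutes_funpow[OF s]] by (simp only: mult_ac)
qed

lemma pol_trace_Suc:
  assumes n: "n \<ge> 1" and s: "s permutes {1..n}"
  shows "pol_trace n s (Suc k) =
    (\<Sum>r\<le>k. (- 1) ^ r * (real n * of_bool ((s ^^ Suc r) n = n) - 1) * ext_trace n s (k - r))"
proof -
  have "pol_trace n s (Suc k) = (\<Sum>a\<in>{1..<n}. \<Sum>b\<in>{1..<n}. partial_minor k {1..<n} (std_rep n s) a b)"
    unfolding pol_trace_def by (rule tr_form_polarize_minor_Suc) simp
  also have "\<dots> = (\<Sum>a\<in>{1..<n}. \<Sum>b\<in>{1..<n}. \<Sum>r\<le>k. (- 1) ^ r * ext_trace n s (k - r) * std_rep n (s ^^ Suc r) a b)"
    using partial_minor_powers[of "{1..<n}" "\<lambda>r. std_rep n (s ^^ r)", OF _ std_rep_powers[OF n s]]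
    by (simp add: ext_trace_def)
  also have "\<dots> = (\<Sum>a\<in>{1..<n}. \<Sum>r\<le>k. \<Sum>b\<in>{1..<n}. (- 1) ^ r * ext_trace n s (k - r) * std_rep n (s ^^ Suc r) a b)"
    by (rule sum.cong[OF refl], rule sum.swap)
  also have "\<dots> = (\<Sum>r\<le>k. \<Sum>a\<in>{1..<n}. \<Sum>b\<in>{1..<n}. (- 1) ^ r * ext_trace n s (k - r) * std_rep n (s ^^ Suc r) a b)"
    by (rule sum.swap)
  also have "\<dots> = (\<Sum>r\<le>k. (- 1) ^ r * ext_trace n s (k - r) * (\<Sum>a\<in>{1..<n}. \<Sum>b\<in>{1..<n}. std_rep n (s ^^ Suc r) a b))"
    by (simp only: sum_distrib_left)
  finally show ?thesis
    unfolding std_rep_total[OF n permutes_funpow[OF s]] by (simp only: mult_ac)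
qed

section \<open>Cycle lengths and fixed points of powers\<close>

lemma funpow_fixed_iff:
  assumes s: "s permutes A" and A: "finite A"
  shows "(s ^^ r) a = a \<longleftrightarrow> card (orbit s a) dvd r"
proof -
  have "permutation s" using s A by (auto simp: permutation_permutes)
  then have self: "a \<in> orbit s a" by (rule permutation_self_in_orbit)
  define d where "d = funpow_dist1 s a a"
  have "card (orbit s a) = d"
    unfolding orbit_conv_funpow_dist1[OF self] using inj_on_funpow_dist1[OF self]
    by (simp add: card_image d_def)
  moreover have d: "(s ^^ d) a = a" "d > 0"
    unfolding d_def using funpow_dist1_prop[OF self] by auto
  moreover have "(s ^^ r) a = a \<longleftrightarrow> d dvd r"
  proof -
    have "(s ^^ r) a = (s ^^ (r mod d)) a" using funpow_mod_eq[OF d(1)] by simp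
    moreover have "(s ^^ (r mod d)) a \<noteq> a" if "r mod d \<noteq> 0"
      using that d(2) funpow_dist1_least[of "r mod d" s a a] unfolding d_def[symmetric] by simp
    ultimately show ?thesis by (auto simp: dvd_eq_mod_eq_0)
  qed
  ultimately show ?thesis by simp
qed

text \<open>A power of \<open>s\<close> fixes a cycle pointwise if the length divides the exponent,
  and otherwise moves each of its points.\<close>

lemma card_fixed_points_funpow:
  assumes s: "s permutes {1..n}"
  shows "card {a \<in> {1..n}. (s ^^ r) a = a} = (\<Sum>c\<in>#cycle_type n s. if c dvd r then c else 0)"
proof -
  have perm: "permutation s" using s by (auto simp: permutation_permutes)
  let ?O = "orbit s ` {1..n}"
  have orb: "orbit s b = orbit s a" if "b \<in> orbit s a" for a b
    using cyclic_on_orbit'[OF perm, of a] that by (rule orbit_cyclic_eq3)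
  have U: "\<Union>?O = {1..n}"
    using permutes_orbit_subset[OF s] permutation_self_in_orbit[OF perm] by blast
  have "card {a \<in> {1..n}. (s ^^ r) a = a} = (\<Sum>a\<in>{1..n}. if card (orbit s a) dvd r then 1 else 0)"
    by (simp add: funpow_fixed_iff[OF s] sum.inter_filter[symmetric])
  also have "\<dots> = (\<Sum>a\<in>\<Union>?O. if card (orbit s a) dvd r then 1 else 0)"
    by (simp only: U)
  also have "\<dots> = (\<Sum>c\<in>?O. \<Sum>a\<in>c. if card (orbit s a) dvd r then 1 else 0)"
  proof (subst sum.Union_disjoint)
    show "\<forall>A\<in>?O. finite A" using finite_orbit[OF permutation_self_in_orbit[OF perm]] by blast
    show "\<forall>A\<in>?O. \<forall>B\<in>?O. A \<noteq> B \<longrightarrow> A \<inter> B = {}" using orb by blast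
  qed simp
  also have "\<dots> = (\<Sum>c\<in>?O. if card c dvd r then card c else 0)"
  proof (rule sum.cong[OF refl])
    fix c assume "c \<in> ?O"
    then have "orbit s a = c" if "a \<in> c" for a using orb that by blast
    then show "(\<Sum>a\<in>c. if card (orbit s a) dvd r then 1 else 0) = (if card c dvd r then card c else 0)"
      by simp
  qed
  also have "\<dots> = (\<Sum>c\<in>#cycle_type n s. if c dvd r then c else 0)"
    by (simp add: cycle_type_def sum_unfold_sum_mset image_mset.compositionality o_def)
  finally show ?thesis .
qed

lemma cycle_type_is_partition:
  assumes s: "s permutes {1..n}"
  shows "is_partition_of (cycle_type n s) n"
proof -
  have "sum_mset (cycle_type n s) = n"
  proof -
    \<comment> \<open>Exponent 0: every point is fixed and every part divides 0, so the count of
      fixed points is the sum of the parts.\<close>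
    have "{a \<in> {1..n}. (s ^^ 0) a = a} = {1..n}" by auto
    then show ?thesis using card_fixed_points_funpow[OF s, of 0] by simp
  qed
  moreover have "permutation s" using s by (auto simp: permutation_permutes)
  then have "card (orbit s a) \<noteq> 0" for a
    using finite_orbit[OF permutation_self_in_orbit] orbit_nonempty[of s a] by (simp add: card_eq_0_iff)
  then have "0 \<notin> (\<lambda>a. card (orbit s a)) ` {1..n}" by (metis imageE)
  then have "0 \<notin># cycle_type n s" by (simp add: cycle_type_def image_image)
  ultimately show ?thesis by (simp add: is_partition_of_def)
qed

section \<open>Generating functions of the traces\<close>

text \<open>The series x d/dx log(1 - (-x)^c). The constant coefficient is treated separately
  because c divides 0.\<close>

definition log_deriv :: "nat \<Rightarrow> real fps" where
  "log_deriv c = Abs_fps (\<lambda>r. if r = 0 \<or> \<not> c dvd r then 0 else (- 1) ^ (r - 1) * of_nat c)"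

lemma neg_fps_X_power: "(- fps_X :: real fps) ^ c = fps_const ((- 1) ^ c) * fps_X ^ c"
  by (subst power_minus) (simp add: fps_const_power[symmetric] fps_const_neg[symmetric] del: fps_const_power fps_const_neg)

lemma log_deriv_mult:
  assumes c: "c \<ge> 1"
  shows "log_deriv c * (1 - (- fps_X) ^ c) = - of_nat c * (- fps_X) ^ c"
proof (rule fps_ext)
  fix r
  have lhs: "(log_deriv c * (1 - (- fps_X) ^ c)) $ r =
      log_deriv c $ r - (- 1) ^ c * (if r < c then 0 else log_deriv c $ (r - c))"
  proof -
    have "log_deriv c * (1 - (- fps_X) ^ c) =
        log_deriv c - fps_const ((- 1) ^ c) * (fps_X ^ c * log_deriv c)"
      unfolding neg_fps_X_power by (simp add: algebra_simps)
    then show ?thesis by (simp add: fps_X_power_mult_nth)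
  qed
  have rhs: "(- of_nat c * (- fps_X) ^ c :: real fps) $ r = - of_nat c * (- 1) ^ c * of_bool (r = c)"
  proof -
    have "- of_nat c * (- fps_X) ^ c = fps_const (- of_nat c * (- 1) ^ c) * (fps_X ^ c :: real fps)"
      unfolding neg_fps_X_power
      by (simp add: fps_of_nat[symmetric] mult.assoc[symmetric] fps_const_mult[symmetric]
          fps_const_neg[symmetric] del: fps_const_mult fps_const_neg)
    then show ?thesis by (simp add: fps_X_power_nth)
  qed
  consider "r < c" | "r = c" | "r > c" by linarith
  then show "(log_deriv c * (1 - (- fps_X) ^ c)) $ r = (- of_nat c * (- fps_X) ^ c) $ r"
  proof cases
    case 1
    then have "r = 0 \<or> \<not> c dvd r" using nat_dvd_not_less by auto
    then show ?thesis unfolding lhs rhs using 1 by (auto simp: log_deriv_def)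
  next
    \<comment> \<open>The shifted term is the constant coefficient, which is 0; so there is no
      cancellation here, unlike beyond c.\<close>
    case 2
    have "(- 1 :: real) ^ (c - 1) = - ((- 1) ^ c)" using c by (cases c) auto
    then show ?thesis unfolding lhs rhs using 2 c by (simp add: log_deriv_def)
  next
    case 3
    have "c dvd r \<longleftrightarrow> c dvd r - c" using 3 by (simp add: dvd_minus_self)
    moreover have "(- 1 :: real) ^ (r - 1) = (- 1) ^ c * (- 1) ^ (r - c - 1)"
      using 3 by (simp add: power_add[symmetric])
    ultimately show ?thesis unfolding lhs rhs using 3 by (simp add: log_deriv_def)
  qed
qed

lemma log_deriv_factor:
  assumes c: "c \<ge> 1"
  shows "fps_X * fps_deriv (1 - (- fps_X) ^ c) = log_deriv c * (1 - (- fps_X) ^ c)"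
proof -
  obtain d where d: "c = Suc d" using c by (cases c) auto
  have "fps_deriv ((- fps_X :: real fps) ^ Suc d) = - of_nat (Suc d) * (- fps_X) ^ d"
    by (subst fps_deriv_power) (simp add: fps_of_nat[symmetric] del: of_nat_Suc)
  then show ?thesis
    unfolding log_deriv_mult[OF c] unfolding d fps_deriv_sub by (simp del: of_nat_Suc)
qed

lemma H_series_deriv:
  assumes "0 \<notin># nu"
  shows "fps_X * fps_deriv (H_series nu) = (\<Sum>c\<in>#nu. log_deriv c) * H_series nu"
  using assms
proof (induction nu)
  case (add c nu)
  let ?g = "1 - (- fps_X :: real fps) ^ c"
  have H: "H_series (add_mset c nu) = ?g * H_series nu" by (simp add: H_series_def)
  have "fps_X * fps_deriv (H_series (add_mset c nu)) =
      (fps_X * fps_deriv ?g) * H_series nu + ?g * (fps_X * fps_deriv (H_series nu))"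
    unfolding H fps_deriv_mult by (simp only: algebra_simps)
  also have "fps_X * fps_deriv ?g = log_deriv c * ?g"
    by (rule log_deriv_factor) (use add.prems in auto)
  also have "fps_X * fps_deriv (H_series nu) = (\<Sum>c\<in>#nu. log_deriv c) * H_series nu"
    using add by simp
  finally show ?case unfolding H by (simp add: algebra_simps)
qed (simp add: H_series_def)

text \<open>As \<open>L\<close> has no constant term, each coefficient of a solution, multiplied by
  its index, is expressed through the earlier ones.\<close>

lemma fps_log_deriv_unique:
  fixes E F L :: "real fps"
  assumes E: "fps_X * fps_deriv E = L * E" and F: "fps_X * fps_deriv F = L * F"
    and L: "L $ 0 = 0" and 0: "E $ 0 = F $ 0"
  shows "E = F"
proof (rule fps_ext)
  have step: "real (Suc k) * G $ Suc k = (\<Sum>i=1..Suc k. L $ i * G $ (Suc k - i))"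
    if "fps_X * fps_deriv G = L * G" for G k
  proof -
    have "real (Suc k) * G $ Suc k = (fps_X * fps_deriv G) $ Suc k" by simp
    also have "\<dots> = (\<Sum>i=0..Suc k. L $ i * G $ (Suc k - i))" unfolding that by (rule fps_mult_nth)
    also have "\<dots> = (\<Sum>i=1..Suc k. L $ i * G $ (Suc k - i))"
      using L by (subst sum.atLeast_Suc_atMost) auto
    finally show ?thesis .
  qed
  fix k
  show "E $ k = F $ k"
  proof (induction k rule: less_induct)
    case (less k)
    show ?case
    proof (cases k)
      case (Suc l)
      have "real (Suc l) * E $ Suc l = real (Suc l) * F $ Suc l"
        unfolding step[OF E] step[OF F] using less Suc by (intro sum.cong refl) auto
      then show ?thesis using Suc by simp
    qed (simp add: 0)
  qed
qed

lemma fps_div_one_plus_X: "(f / (1 + fps_X :: real fps)) * (1 + fps_X) = f"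
  by (subst fps_divide_unit) (auto simp: mult.assoc inverse_mult_eq_1)

lemma one_plus_X_nonzero: "(1 + fps_X :: real fps) \<noteq> 0"
proof
  assume "(1 + fps_X :: real fps) = 0"
  then have "(1 + fps_X :: real fps) $ 0 = 0 $ 0" by (rule arg_cong)
  then show False by simp
qed

text \<open>Newton's identities form a linear differential equation whose logarithmic derivative is
  made of the numbers of fixed points. The cycles contribute \<open>H_series\<close>; the trivial
  constituent of the permutation module, to be removed, contributes the denominator 1 + x.\<close>

lemma ext_trace_fps:
  assumes n: "n \<ge> 1" and s: "s permutes {1..n}"
  shows "Abs_fps (ext_trace n s) = H_series (cycle_type n s) / (1 + fps_X)"
proof (rule fps_log_deriv_unique)
  let ?E = "Abs_fps (ext_trace n s)" and ?H = "H_series (cycle_type n s)"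
  let ?F = "?H / (1 + fps_X)"
  let ?L = "(\<Sum>c\<in>#cycle_type n s. log_deriv c) - log_deriv 1"
  have pos: "0 \<notin># cycle_type n s" using cycle_type_is_partition[OF s] by (simp add: is_partition_of_def)
  have L: "?L $ r = (if r = 0 then 0 else (- 1) ^ (r - 1) * (real (card {a \<in> {1..n}. (s ^^ r) a = a}) - 1))"
    for r
  proof -
    have "(\<Sum>c\<in>#M. log_deriv c) $ r =
        (if r = 0 then 0 else (- 1) ^ (r - 1) * real (\<Sum>c\<in>#M. if c dvd r then c else 0))" for M
      by (induction M) (auto simp: log_deriv_def algebra_simps)
    then show ?thesis
      unfolding card_fixed_points_funpow[OF s] by (simp add: log_deriv_def right_diff_distrib)
  qed
  show L0: "?L $ 0 = 0" by (subst L) simp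
  show "fps_X * fps_deriv ?E = ?L * ?E"
  proof (rule fps_ext)
    fix r
    show "(fps_X * fps_deriv ?E) $ r = (?L * ?E) $ r"
    proof (cases r)
      case 0
      then show ?thesis using L0 by simp
    next
      case (Suc k)
      have "(?L * ?E) $ Suc k = (\<Sum>i=0..Suc k. ?L $ i * ext_trace n s (Suc k - i))"
        by (simp add: fps_mult_nth)
      also have "\<dots> = (\<Sum>i\<le>k. ?L $ Suc i * ext_trace n s (k - i))"
        unfolding atLeast0AtMost by (subst sum.atMost_Suc_shift) (use L0 in simp)
      also have "\<dots> = real (Suc k) * ext_trace n s (Suc k)"
        unfolding ext_trace_Suc[OF n s] by (intro sum.cong refl) (simp only: L, simp)
      finally show ?thesis using Suc by simp
    qed
  qed
  show "fps_X * fps_deriv ?F = ?L * ?F"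
  proof -
    let ?X1 = "1 + fps_X :: real fps"
    have H: "?F * ?X1 = ?H" by (rule fps_div_one_plus_X)
    have X: "fps_X * fps_deriv ?X1 = log_deriv 1 * ?X1"
      using log_deriv_factor[of 1] by simp
    have "fps_X * fps_deriv ?F * ?X1 = fps_X * fps_deriv (?F * ?X1) - ?F * (fps_X * fps_deriv ?X1)"
      unfolding fps_deriv_mult by (simp add: algebra_simps)
    also have "\<dots> = (\<Sum>c\<in>#cycle_type n s. log_deriv c) * (?F * ?X1) - ?F * (log_deriv 1 * ?X1)"
      unfolding X unfolding H H_series_deriv[OF pos] ..
    also have "\<dots> = ?L * ?F * ?X1" by (simp only: algebra_simps)
    finally show ?thesis using one_plus_X_nonzero by (simp only: mult_cancel_right) simp
  qed
  show "?E $ 0 = ?F $ 0"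
  proof -
    have "H_series M $ 0 = 1" if "0 \<notin># M" for M
      using that by (induction M) (auto simp: H_series_def)
    then show ?thesis
      using pos by (simp add: ext_trace_def tr_form_def fps_divide_unit)
  qed
qed

text \<open>The factor n / i turns the coefficients i of \<open>log_deriv i\<close> into n; they sit
  at the multiples of i, the exponents for which the power of \<open>s\<close> fixes n.\<close>

lemma pol_trace_fps:
  assumes n: "n \<ge> 1" and s: "s permutes {1..n}"
  defines "i \<equiv> card (orbit s n)"
  shows "Abs_fps (pol_trace n s) =
    (fps_const (real n / real i) * log_deriv i - log_deriv 1) * Abs_fps (ext_trace n s)"
proof (rule fps_ext)
  let ?L = "fps_const (real n / real i) * log_deriv i - log_deriv 1"
  have "permutation s" using s by (auto simp: permutation_permutes)
  then have i: "i \<noteq> 0" unfolding i_def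
    using finite_orbit[OF permutation_self_in_orbit] orbit_nonempty[of s n] by (simp add: card_eq_0_iff)
  have L: "?L $ r = (if r = 0 then 0 else (- 1) ^ (r - 1) * (real n * of_bool ((s ^^ r) n = n) - 1))" for r
    using i unfolding funpow_fixed_iff[OF s finite_atLeastAtMost] i_def[symmetric]
    by (simp add: log_deriv_def right_diff_distrib)
  have L0: "?L $ 0 = 0" by (subst L) simp
  fix r
  show "Abs_fps (pol_trace n s) $ r = (?L * Abs_fps (ext_trace n s)) $ r"
  proof (cases r)
    case 0
    then show ?thesis using L0 by (simp add: pol_trace_def tr_form_def polarize_def)
  next
    case (Suc k)
    have "(?L * Abs_fps (ext_trace n s)) $ Suc k = (\<Sum>i=0..Suc k. ?L $ i * ext_trace n s (Suc k - i))"
      by (simp add: fps_mult_nth)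
    also have "\<dots> = (\<Sum>i\<le>k. ?L $ Suc i * ext_trace n s (k - i))"
      unfolding atLeast0AtMost by (subst sum.atMost_Suc_shift) (use L0 in simp)
    also have "\<dots> = pol_trace n s (Suc k)"
      unfolding pol_trace_Suc[OF n s] by (intro sum.cong refl) (simp only: L, simp)
    finally show ?thesis using Suc by simp
  qed
qed

section \<open>The series R and S as generating functions of traces\<close>

lemma R_series_mult: "R_series n i * (1 + fps_X) = (of_nat n - 1) + of_nat n * fps_X + (- fps_X) ^ i"
  unfolding R_series_def by (rule fps_div_one_plus_X)

text \<open>Powers of (-x)^i are what the logarithmic derivatives produce; the signs (-1)^(i-1) and
  (-1)^i multiply to -1.\<close>

lemma S_series_mult:
  assumes "i \<ge> 1"
  shows "S_series n i * (1 + fps_X) =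
    - fps_X - of_nat n * (- fps_X) ^ i - (of_nat n - 1) * fps_X * (- fps_X) ^ i"
proof -
  have "S_series n i * (1 + fps_X) =
      (- 1) ^ (i - 1) * ((- 1) ^ i * fps_X + of_nat n * fps_X ^ i + (of_nat n - 1) * fps_X ^ (i + 1))"
    unfolding S_series_def mult.assoc fps_div_one_plus_X ..
  also have "\<dots> = - fps_X - of_nat n * ((- 1) ^ i * fps_X ^ i) - (of_nat n - 1) * fps_X * ((- 1) ^ i * fps_X ^ i)"
  proof -
    obtain d where d: "i = Suc d" using assms by (cases i) auto
    have "(- 1 :: real fps) ^ d * (- 1) ^ d = 1" by (simp add: power_mult_distrib[symmetric])
    then have "(- 1 :: real fps) ^ d * ((- 1) ^ d * y) = y" for y by (simp add: mult.assoc[symmetric])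
    then show ?thesis unfolding d by (simp add: algebra_simps)
  qed
  also have "(- 1) ^ i * fps_X ^ i = (- fps_X :: real fps) ^ i"
    by (simp add: power_minus[symmetric])
  finally show ?thesis .
qed

lemma marked_class_D:
  assumes "s \<in> marked_class n lam i"
  shows "s permutes {1..n}" "cycle_type n s = lam" "card (orbit s n) = i"
  using assms by (auto simp: marked_class_def)

lemma ext_trace_marked:
  assumes n: "n \<ge> 1" and s: "s \<in> marked_class n lam i" and i: "i \<in># lam"
  shows "Abs_fps (ext_trace n s) = (1 - (- fps_X) ^ i) * (H_series (lam - {#i#}) / (1 + fps_X))"
proof -
  have "lam = add_mset i (lam - {#i#})" using i by simp
  then have "H_series lam = (1 - (- fps_X) ^ i) * H_series (lam - {#i#})"
    by (metis H_series_def image_mset_add_mset prod_mset.add_mset)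
  moreover have "Abs_fps (ext_trace n s) * (1 + fps_X) = H_series lam"
    unfolding ext_trace_fps[OF n marked_class_D(1)[OF s]] marked_class_D(2)[OF s]
    by (rule fps_div_one_plus_X)
  moreover have "(1 - (- fps_X) ^ i) * (H_series (lam - {#i#}) / (1 + fps_X)) * (1 + fps_X)
      = (1 - (- fps_X) ^ i) * H_series (lam - {#i#})"
    unfolding mult.assoc fps_div_one_plus_X ..
  ultimately show ?thesis using one_plus_X_nonzero by (metis mult_right_cancel)
qed

text \<open>The factor 1 - (-x)^i of the marked part clears the denominator of
  \<open>log_deriv i\<close>, and what is left is \<open>S_series\<close>.\<close>

lemma pol_trace_marked:
  assumes n: "n \<ge> 1" and s: "s \<in> marked_class n lam i" and i: "i \<in># lam" "i \<ge> 1"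
  shows "Abs_fps (pol_trace n s) = S_series n i * (H_series (lam - {#i#}) / (1 + fps_X))"
proof -
  let ?F = "H_series (lam - {#i#}) / (1 + fps_X)" and ?Y = "(- fps_X :: real fps) ^ i"
  have c: "fps_const (real n / real i) * of_nat i = (of_nat n :: real fps)"
    using i(2) by (simp add: fps_of_nat[symmetric])
  have l1: "log_deriv 1 * (1 + fps_X) = fps_X" using log_deriv_mult[of 1] by simp
  have "Abs_fps (pol_trace n s) * (1 + fps_X) =
      (fps_const (real n / real i) * (log_deriv i * (1 - ?Y)) * (1 + fps_X)
        - (log_deriv 1 * (1 + fps_X)) * (1 - ?Y)) * ?F"
    unfolding pol_trace_fps[OF n marked_class_D(1)[OF s]] marked_class_D(3)[OF s]
      ext_trace_marked[OF n s i(1)] by (simp only: algebra_simps)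
  also have "\<dots> = (- ((fps_const (real n / real i) * of_nat i) * ?Y) * (1 + fps_X) - fps_X * (1 - ?Y)) * ?F"
    unfolding l1 log_deriv_mult[OF i(2)] by (simp only: mult_minus_left mult_minus_right mult.assoc)
  also have "\<dots> = S_series n i * (1 + fps_X) * ?F"
    unfolding c S_series_mult[OF i(2)] by (simp only: algebra_simps) simp
  also have "\<dots> = S_series n i * ?F * (1 + fps_X)" by (simp only: mult_ac)
  finally show ?thesis using one_plus_X_nonzero by (metis mult_right_cancel)
qed

text \<open>This rests on R + S = (n - 1)(1 - (-x)^i). The left-hand side is n - 1 times the trace
  against the projection onto the summand that the derivation kills.\<close>

lemma ext_minus_pol_marked:
  assumes n: "n \<ge> 1" and s: "s \<in> marked_class n lam i" and i: "i \<in># lam" "i \<ge> 1"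
  shows "(of_nat n - 1) * Abs_fps (ext_trace n s) - Abs_fps (pol_trace n s) =
    R_series n i * (H_series (lam - {#i#}) / (1 + fps_X))"
proof -
  let ?Y = "(- fps_X :: real fps) ^ i"
  have "R_series n i * (1 + fps_X) + S_series n i * (1 + fps_X) = (of_nat n - 1) * (1 - ?Y) * (1 + fps_X)"
    unfolding R_series_mult S_series_mult[OF i(2)] by (simp only: algebra_simps) simp
  then have "(R_series n i + S_series n i) * (1 + fps_X) = (of_nat n - 1) * (1 - ?Y) * (1 + fps_X)"
    by (simp only: distrib_right)
  then have RS: "R_series n i + S_series n i = (of_nat n - 1) * (1 - ?Y)"
    using one_plus_X_nonzero by (metis mult_right_cancel)
  show ?thesis
    unfolding ext_trace_marked[OF n s i(1)] pol_trace_marked[OF n s i] mult.assoc[symmetric] RS[symmetric]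
    by (simp only: algebra_simps)
qed

text \<open>The space has dimension n - 1: a tuple of n or more indices has a repetition, and its
  minor has two equal columns.\<close>

lemma ext_trace_eq_0:
  assumes "k \<ge> n" "n \<ge> 1"
  shows "ext_trace n s k = 0"
proof -
  have "minor k (std_rep n s) f f = 0" if f: "f \<in> tuples k {1..<n}" for f
  proof -
    have "\<not> inj_on f {..<k}"
    proof
      assume "inj_on f {..<k}"
      then have "card {..<k} \<le> card {1..<n}"
        using tuples_image[OF f] by (intro card_inj_on_le) auto
      then show False using assms by simp
    qed
    then obtain a b where ab: "a < k" "b < k" "a \<noteq> b" "f a = f b" by (auto simp: inj_on_def)
    then have "f \<circ> transpose a b = f" by (auto simp: fun_eq_iff transpose_def)
    moreover have "transpose a b permutes {..<k}" using ab by (intro permutes_swap_id) auto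
    ultimately show ?thesis
      using minor_col_perm[of "transpose a b" k "std_rep n s" f f] ab by (simp add: sign_swap_id)
  qed
  then show ?thesis by (simp add: ext_trace_def tr_form_def)
qed

text \<open>
  The alternating sum of the exterior traces is \<open>det (1 - s)\<close> on the standard representation, hence
  it detects the \<open>n\<close>-cycles.
\<close>

lemma alternating_ext_trace:
  assumes n: "n \<ge> 1" and s: "s permutes {1..n}"
  shows "(\<Sum>k<n. (- 1) ^ k * ext_trace n s k) = real n * of_bool (cyclic_on s {1..n})"
proof -
  define lam where "lam = cycle_type n s"
  define i where "i = card (orbit s n)"
  define nu where "nu = lam - {#i#}"
  let ?y = "- [:0, 1:] :: real poly"
  \<comment> \<open>At x = -1 both 1 - (-x)^i and 1 + x vanish. Their quotient is this geometric
    sum, with value i there; the passage to polynomials makes the evaluation meaningful.\<close>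
  define G where "G = (\<Sum>j<i. ?y ^ j)"
  define Q where "Q = G * (\<Prod>r\<in>#nu. 1 - ?y ^ r)"
  have mem: "s \<in> marked_class n lam i" using s by (simp add: marked_class_def lam_def i_def)
  have "orbit s n \<in> orbit s ` {1..n}" using n by auto
  then have i: "i \<in># lam" unfolding lam_def i_def cycle_type_def by auto
  have part: "0 \<notin># lam" "sum_mset lam = n"
    using cycle_type_is_partition[OF s] by (auto simp: is_partition_of_def lam_def)
  have lam: "lam = add_mset i nu" using i by (simp add: nu_def)
  have y: "fps_of_poly ?y = - fps_X" by (simp add: fps_of_poly_uminus)
  have H: "fps_of_poly (\<Prod>r\<in>#M. 1 - ?y ^ r) = H_series M" for M
    unfolding H_series_def
    by (induction M) (simp_all only: image_mset_empty image_mset_add_mset prod_mset_empty prod_mset.add_mset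
        fps_of_poly_1 fps_of_poly_mult fps_of_poly_diff fps_of_poly_power y)
  have "G * (1 - ?y) = 1 - ?y ^ i"
    unfolding G_def by (subst mult.commute) (rule one_diff_power_eq[symmetric])
  then have "fps_of_poly (G * (1 - ?y)) = fps_of_poly (1 - ?y ^ i)" by (rule arg_cong)
  then have "fps_of_poly G * (1 - (- fps_X)) = 1 - (- fps_X) ^ i"
    by (simp only: fps_of_poly_mult fps_of_poly_diff fps_of_poly_power y fps_of_poly_1)
  then have G: "fps_of_poly G * (1 + fps_X) = 1 - (- fps_X) ^ i"
    by (simp only: diff_minus_eq_add)
  have "Abs_fps (ext_trace n s) * (1 + fps_X) = fps_of_poly Q * (1 + fps_X)"
    unfolding ext_trace_marked[OF n mem i] mult.assoc fps_div_one_plus_X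
    unfolding Q_def fps_of_poly_mult H G[symmetric] nu_def by (simp only: mult_ac)
  then have "Abs_fps (ext_trace n s) = fps_of_poly Q"
    using one_plus_X_nonzero by (metis mult_right_cancel)
  then have coeff: "ext_trace n s k = coeff Q k" for k
    by (metis fps_nth_Abs_fps fps_of_poly_nth)
  \<comment> \<open>With this bound the sum over k < n is the whole value of \<open>Q\<close> at
    -1.\<close>
  have "degree Q \<le> n - 1"
    using ext_trace_eq_0[OF _ n] by (intro degree_le) (auto simp: coeff[symmetric])
  then have "poly Q (- 1) = (\<Sum>k\<le>n - 1. coeff Q k * (- 1) ^ k)"
    unfolding poly_altdef by (intro sum.mono_neutral_left) (auto simp: coeff_eq_0)
  also have "\<dots> = (\<Sum>k<n. (- 1) ^ k * ext_trace n s k)"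
    using n by (intro sum.cong) (auto simp: coeff)
  finally have sum: "(\<Sum>k<n. (- 1) ^ k * ext_trace n s k) = poly Q (- 1)" ..
  have "poly G (- 1) = real i" unfolding G_def by (simp add: poly_sum)
  then have Q: "poly Q (- 1) = real i * poly (\<Prod>r\<in>#nu. 1 - ?y ^ r) (- 1)" by (simp add: Q_def)
  have orb: "orbit s n \<subseteq> {1..n}" using permutes_orbit_subset[OF s, of n] n by auto
  show ?thesis
  proof (cases "cyclic_on s {1..n}")
    case True
    then have "orbit s n = {1..n}" using n by (intro orbit_cyclic_eq3) auto
    then have "i = n" by (simp add: i_def)
    then have "sum_mset nu = 0" using part lam by simp
    then have "nu = {#}" using part lam by (cases nu) auto
    then show ?thesis using True \<open>i = n\<close> Q sum by simp
  next
    case False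
    have "orbit s n \<noteq> {1..n}" using False n unfolding cyclic_on_def by fastforce
    then have "i \<noteq> n" unfolding i_def using orb card_subset_eq[of "{1..n}" "orbit s n"] by auto
    then have "nu \<noteq> {#}" using part lam by auto
    then obtain r nu' where "nu = add_mset r nu'" by (meson multiset_cases)
    \<comment> \<open>A further cycle of length r brings the factor 1 - (-x)^r, which vanishes at
      -1.\<close>
    then have "poly Q (- 1) = 0" unfolding Q by simp
    then show ?thesis using False sum by simp
  qed
qed

section \<open>Marked classes\<close>

lemma conj_permutes:
  assumes "w permutes A" "s permutes A"
  shows "w \<circ> s \<circ> inv w permutes A"
  using assms by (intro permutes_compose permutes_inv)

lemma orbit_conj:
  assumes w: "w permutes A" and s: "s permutes A" and A: "finite A"
  shows "orbit (w \<circ> s \<circ> inv w) (w a) = w ` orbit s a"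
proof -
  have "permutation s" using s A by (auto simp: permutation_permutes)
  then have "a \<in> orbit s a" by (rule permutation_self_in_orbit)
  then show ?thesis
    by (intro orbit_inverse[symmetric]) (simp_all add: permutes_inverses[OF w])
qed

lemma cycle_type_conj:
  assumes w: "w permutes {1..n}" and s: "s permutes {1..n}"
  shows "cycle_type n (w \<circ> s \<circ> inv w) = cycle_type n s"
proof -
  let ?t = "w \<circ> s \<circ> inv w"
  have inj: "inj w" using w by (rule permutes_inj)
  have "orbit ?t ` {1..n} = orbit ?t ` (w ` {1..n})" using permutes_image[OF w] by simp
  also have "\<dots> = image w ` (orbit s ` {1..n})"
    using orbit_conj[OF w s] by (simp add: image_image)
  finally have "cycle_type n ?t = image_mset card (image_mset (image w) (mset_set (orbit s ` {1..n})))"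
    unfolding cycle_type_def using inj by (subst image_mset_mset_set) (auto intro!: inj_onI simp: inj_image_eq_iff)
  also have "\<dots> = cycle_type n s"
  proof -
    have "card (w ` X) = card X" for X
      by (rule card_image[OF inj_on_subset[OF inj subset_UNIV]])
    then show ?thesis by (simp add: cycle_type_def image_mset.compositionality o_def)
  qed
  finally show ?thesis .
qed

text \<open>Since \<open>w\<close> fixes n, it carries the cycle of n to the cycle of n in the
  conjugate, so the marked length is preserved along with the cycle type.\<close>

lemma marked_class_conj:
  assumes w: "w permutes {1..<n}" and s: "s \<in> marked_class n lam i"
  shows "w \<circ> s \<circ> inv w \<in> marked_class n lam i"
proof -
  have w': "w permutes {1..n}" using w by (rule permutes_subset) auto
  note s' = marked_class_D[OF s]
  have "w n = n" using w by (auto simp: permutes_def)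
  then have "orbit (w \<circ> s \<circ> inv w) n = w ` orbit s n"
    using orbit_conj[OF w' s'(1), of n] by simp
  then have "card (orbit (w \<circ> s \<circ> inv w) n) = i"
    using permutes_inj_on[OF w'] s'(3) by (simp add: card_image)
  then show ?thesis
    using conj_permutes[OF w' s'(1)] cycle_type_conj[OF w' s'(1)] s'(2) by (simp add: marked_class_def)
qed

lemma finite_marked_class [simp]: "finite (marked_class n lam i)"
proof (rule finite_subset)
  show "marked_class n lam i \<subseteq> {p. p permutes {1..n}}" by (auto simp: marked_class_def)
qed (simp add: finite_permutations)

lemma inv_conj:
  assumes w: "w permutes A"
  shows "inv w \<circ> (w \<circ> s \<circ> inv w) \<circ> w = s" "w \<circ> (inv w \<circ> s \<circ> w) \<circ> inv w = s"
  using permutes_inverses[OF w] by (auto simp: fun_eq_iff)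

lemma sum_marked_class_conj:
  assumes w: "w permutes {1..<n}"
  shows "(\<Sum>s\<in>marked_class n lam i. h (w \<circ> s \<circ> inv w)) = (\<Sum>s\<in>marked_class n lam i. h s)"
proof (rule sum.reindex_bij_witness[where i = "\<lambda>s. inv w \<circ> s \<circ> w" and j = "\<lambda>s. w \<circ> s \<circ> inv w"])
  fix s assume s: "s \<in> marked_class n lam i"
  show "inv w \<circ> (w \<circ> s \<circ> inv w) \<circ> w = s" "w \<circ> (inv w \<circ> s \<circ> w) \<circ> inv w = s"
    by (rule inv_conj[OF w])+
  show "w \<circ> s \<circ> inv w \<in> marked_class n lam i" using w s by (rule marked_class_conj)
  show "inv w \<circ> s \<circ> w \<in> marked_class n lam i"
    using marked_class_conj[OF permutes_inv[OF w] s] by (simp add: permutes_inv_inv[OF w])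
qed simp

section \<open>Class sums on exterior powers\<close>

definition class_form :: "nat \<Rightarrow> (nat \<Rightarrow> nat) set \<Rightarrow> nat \<Rightarrow> (nat \<Rightarrow> nat) \<Rightarrow> (nat \<Rightarrow> nat) \<Rightarrow> real" where
  "class_form n A k f g = (\<Sum>s\<in>A. minor k (std_rep n s) f g)"

lemma alt_inv_class_form:
  "alt_inv k {1..<n} (class_form n (marked_class n lam i) k)"
  unfolding alt_inv_def
proof (intro conjI allI impI)
  fix f g f' g' :: "nat \<Rightarrow> nat" assume "\<forall>i<k. f i = f' i \<and> g i = g' i"
  then show "class_form n (marked_class n lam i) k f g = class_form n (marked_class n lam i) k f' g'"
    unfolding class_form_def by (intro sum.cong refl minor_cong) auto
next
  fix f g w :: "nat \<Rightarrow> nat" assume w: "w permutes {1..<n}"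
  have wn: "w n = n" "inv w n = n"
    using w permutes_inv[OF w] by (auto simp: permutes_def)
  \<comment> \<open>Relabelling the basis by \<open>w\<close> exchanges the matrix of
    \<open>s\<close> with that of its conjugate; summed over the class this becomes
    invariance.\<close>
  have "std_rep n (w \<circ> s \<circ> inv w) (w a) (w b) = std_rep n s a b" for s a b
    using permutes_inj[OF w] wn by (simp add: std_rep_def permutes_inverses[OF w] inj_eq)
  then have "minor k (std_rep n (w \<circ> s \<circ> inv w)) (w \<circ> f) (w \<circ> g) = minor k (std_rep n s) f g" for s
    by (simp add: minor_def)
  then show "class_form n (marked_class n lam i) k (w \<circ> f) (w \<circ> g) = class_form n (marked_class n lam i) k f g"
    using sum_marked_class_conj[OF w, of "\<lambda>s. minor k (std_rep n s) (w \<circ> f) (w \<circ> g)" lam i]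
    by (simp add: class_form_def)
qed (simp_all add: class_form_def minor_row_perm minor_col_perm sum_distrib_left)

lemma tr_form_class_form: "tr_form k {1..<n} (class_form n A k) = (\<Sum>s\<in>A. ext_trace n s k)"
  unfolding tr_form_def class_form_def ext_trace_def sum_divide_distrib by (rule sum.swap)

lemma tr_form_polarize_class_form:
  "tr_form k {1..<n} (polarize k {1..<n} (class_form n A k)) = (\<Sum>s\<in>A. pol_trace n s k)"
proof -
  let ?S = "{1..<n}"
  have "polarize k ?S (class_form n A k) f f = (\<Sum>s\<in>A. polarize k ?S (minor k (std_rep n s)) f f)" for f
  proof -
    have "polarize k ?S (class_form n A k) f f =
        (\<Sum>t<k. \<Sum>s\<in>A. \<Sum>b\<in>?S. minor k (std_rep n s) (f(t := b)) f)"
      unfolding polarize_def class_form_def by (rule sum.cong[OF refl], rule sum.swap)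
    also have "\<dots> = (\<Sum>s\<in>A. polarize k ?S (minor k (std_rep n s)) f f)"
      unfolding polarize_def by (rule sum.swap)
    finally show ?thesis .
  qed
  then have "(\<Sum>f\<in>tuples k ?S. polarize k ?S (class_form n A k) f f) =
      (\<Sum>s\<in>A. \<Sum>f\<in>tuples k ?S. polarize k ?S (minor k (std_rep n s)) f f)"
    by (simp only: sum.swap[of _ A])
  then show ?thesis
    by (simp only: tr_form_def pol_trace_def sum_divide_distrib)
qed

lemma minor_mat_cong:
  assumes "\<And>i j. i < k \<Longrightarrow> j < k \<Longrightarrow> M (f i) (g j) = N (f i) (g j)"
  shows "minor k M f g = minor k N f g"
  unfolding minor_def
proof (rule sum.cong[OF refl])
  fix p assume "p \<in> {p. p permutes {..<k}}"
  then have p: "p i < k" if "i < k" for i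
    using that permutes_in_image by fastforce
  show "of_int (sign p) * (\<Prod>i<k. M (f i) (g (p i))) = of_int (sign p) * (\<Prod>i<k. N (f i) (g (p i)))"
    using assms p by simp
qed

text \<open>Exterior powers are multiplicative. One factor k! comes from Cauchy-Binet, the other
  from the normalization of the trace.\<close>

lemma ext_trace_comp:
  assumes n: "n \<ge> 1" and t: "t permutes {1..n}"
  shows "ext_trace n (s \<circ> t) k = (\<Sum>f\<in>tuples k {1..<n}. \<Sum>g\<in>tuples k {1..<n}.
    minor k (std_rep n s) f g * minor k (std_rep n t) g f) / (fact k)\<^sup>2"
proof -
  let ?S = "{1..<n}"
  have "(\<Sum>g\<in>tuples k ?S. minor k (std_rep n s) f g * minor k (std_rep n t) g f) =
      fact k * minor k (std_rep n (s \<circ> t)) f f" if f: "f \<in> tuples k ?S" for f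
  proof -
    have "minor k (\<lambda>a b. \<Sum>c\<in>?S. std_rep n s a c * std_rep n t c b) f f = minor k (std_rep n (s \<circ> t)) f f"
      by (rule minor_mat_cong) (use tuples_image[OF f] std_rep_comp[OF n t] in auto)
    then show ?thesis by (simp add: Cauchy_Binet_tuples)
  qed
  then show ?thesis
    by (simp add: ext_trace_def tr_form_def sum_distrib_left[symmetric] power2_eq_square)
qed

lemma sum_ext_trace_comp:
  assumes n: "n \<ge> 1" and B: "\<And>t. t \<in> B \<Longrightarrow> t permutes {1..n}"
  shows "(\<Sum>s\<in>A. \<Sum>t\<in>B. ext_trace n (s \<circ> t) k) =
    (\<Sum>f\<in>tuples k {1..<n}. \<Sum>g\<in>tuples k {1..<n}. class_form n A k f g * class_form n B k g f) / (fact k)\<^sup>2"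
proof -
  let ?T = "tuples k {1..<n}"
  let ?h = "\<lambda>s t f g. minor k (std_rep n s) f g * minor k (std_rep n t) g f"
  have "(\<Sum>s\<in>A. \<Sum>t\<in>B. \<Sum>f\<in>?T. \<Sum>g\<in>?T. ?h s t f g) = (\<Sum>s\<in>A. \<Sum>f\<in>?T. \<Sum>t\<in>B. \<Sum>g\<in>?T. ?h s t f g)"
    by (rule sum.cong[OF refl], rule sum.swap)
  also have "\<dots> = (\<Sum>f\<in>?T. \<Sum>s\<in>A. \<Sum>t\<in>B. \<Sum>g\<in>?T. ?h s t f g)"
    by (rule sum.swap)
  also have "\<dots> = (\<Sum>f\<in>?T. \<Sum>s\<in>A. \<Sum>g\<in>?T. \<Sum>t\<in>B. ?h s t f g)"
    by (rule sum.cong[OF refl], rule sum.cong[OF refl], rule sum.swap)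
  also have "\<dots> = (\<Sum>f\<in>?T. \<Sum>g\<in>?T. \<Sum>s\<in>A. \<Sum>t\<in>B. ?h s t f g)"
    by (rule sum.cong[OF refl], rule sum.swap)
  also have "\<dots> = (\<Sum>f\<in>?T. \<Sum>g\<in>?T. class_form n A k f g * class_form n B k g f)"
    by (simp only: class_form_def sum_product)
  finally have "(\<Sum>s\<in>A. \<Sum>t\<in>B. \<Sum>f\<in>?T. \<Sum>g\<in>?T. ?h s t f g) =
    (\<Sum>f\<in>?T. \<Sum>g\<in>?T. class_form n A k f g * class_form n B k g f)" .
  then show ?thesis
    using ext_trace_comp[OF n B] by (simp add: sum_divide_distrib[symmetric])
qed

section \<open>Factorizations of an n-cycle\<close>

lemma n_cycle_funpow:
  fixes n :: nat
  assumes n: "n \<ge> 1" and c: "c permutes {1..n}" "cyclic_on c {1..n}"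
  shows "(c ^^ n) n = n" "bij_betw (\<lambda>j. (c ^^ j) n) {..<n} {1..n}"
proof -
  have orb: "orbit c n = {1..n}" using c(2) n by (intro orbit_cyclic_eq3) auto
  show fix_n: "(c ^^ n) n = n" by (subst funpow_fixed_iff[OF c(1)]) (simp_all add: orb)
  have im: "(\<lambda>j. (c ^^ j) n) ` {..<n} = {1..n}"
    using orbit_altdef_bounded[OF fix_n] n unfolding orb by auto
  then have "inj_on (\<lambda>j. (c ^^ j) n) {..<n}"
    by (intro eq_card_imp_inj_on) simp_all
  with im show "bij_betw (\<lambda>j. (c ^^ j) n) {..<n} {1..n}"
    by (simp add: bij_betw_def)
qed

text \<open>Both cycles are listed starting from n, and \<open>w\<close> matches the two lists;
  hence it fixes n.\<close>

lemma n_cycles_conj: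
  fixes n :: nat
  assumes n: "n \<ge> 1" and C: "C permutes {1..n}" "cyclic_on C {1..n}"
    and c: "c permutes {1..n}" "cyclic_on c {1..n}"
  obtains w where "w permutes {1..<n}" "c = w \<circ> C \<circ> inv w"
proof -
  note bC = n_cycle_funpow[OF n C] and bc = n_cycle_funpow[OF n c]
  obtain w where w: "w permutes {1..n}" "\<And>j. j \<in> {..<n} \<Longrightarrow> w ((C ^^ j) n) = (c ^^ j) n"
    using permutes_extending[of "{1..n}" "\<lambda>j. (C ^^ j) n" "{..<n}" "\<lambda>j. (c ^^ j) n"] bC(2) bc(2)
    by (auto simp: bij_betw_def)
  have wn: "w n = n" using w(2)[of 0] n by simp
  have "w x = x" if "x \<in> {1..n} - {1..<n}" for x
  proof -
    have "x = n" using that by auto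
    then show ?thesis using wn by simp
  qed
  then have "w permutes {1..<n}" using w(1) by (blast intro: permutes_superset)
  moreover have "w (C x) = c (w x)" for x
  proof (cases "x \<in> {1..n}")
    case True
    then have "x \<in> (\<lambda>j. (C ^^ j) n) ` {..<n}" unfolding bij_betw_imp_surj_on[OF bC(2)] .
    then obtain j where j: "j < n" "x = (C ^^ j) n" by auto
    show ?thesis
    proof (cases "Suc j < n")
      case True
      then show ?thesis using w(2)[of j] w(2)[of "Suc j"] j by simp
    next
      \<comment> \<open>The end of the lists: both cycles return to n, which \<open>w\<close>
        fixes.\<close>
      case False
      then have e: "Suc j = n" using j by simp
      have "(C ^^ Suc j) n = n" "(c ^^ Suc j) n = n" unfolding e by (fact bC(1) bc(1))+
      then have "C x = n" "c ((c ^^ j) n) = n" by (simp_all add: j(2))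
      then show ?thesis using w(2)[of j] j wn by simp
    qed
  next
    case False
    then show ?thesis using C(1) c(1) w(1) by (simp add: permutes_not_in)
  qed
  then have "c = w \<circ> C \<circ> inv w"
    by (simp add: fun_eq_iff permutes_inverses[OF w(1)])
  ultimately show ?thesis by (rule that)
qed

text \<open>The conjugator fixes n, so its values along the cycle \<open>C\<close> starting at n are
  forced by the conjugate.\<close>

lemma n_cycle_conj_inj:
  fixes n :: nat
  assumes n: "n \<ge> 1" and C: "C permutes {1..n}" "cyclic_on C {1..n}"
    and w: "w permutes {1..<n}" "w' permutes {1..<n}"
    and eq: "w \<circ> C \<circ> inv w = w' \<circ> C \<circ> inv w'"
  shows "w = w'"
proof
  fix x
  define c where "c = w \<circ> C \<circ> inv w"
  have pow: "v ((C ^^ j) n) = (c ^^ j) n" if v: "v permutes {1..<n}" "c = v \<circ> C \<circ> inv v" for v j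
  proof (induction j)
    case 0
    then show ?case using v(1) by (auto simp: permutes_def)
  next
    case (Suc j)
    have "v (C y) = c (v y)" for y by (simp add: v(2) permutes_inverses[OF v(1)])
    then show ?case using Suc by simp
  qed
  show "w x = w' x"
  proof (cases "x \<in> {1..n}")
    case True
    then obtain j where j: "x = (C ^^ j) n"
      using bij_betw_imp_surj_on[OF n_cycle_funpow(2)[OF n C]] by (metis imageE)
    show ?thesis using pow[OF w(1) c_def, of j] pow[OF w(2), of j] eq unfolding j c_def by simp
  next
    case False
    then have "x \<notin> {1..<n}" by auto
    then show ?thesis using w by (simp add: permutes_not_in)
  qed
qed

lemma cyclic_on_conj:
  assumes "w permutes A" "cyclic_on C A"
  shows "cyclic_on (w \<circ> C \<circ> inv w) A"
  using cyclic_on_image[OF assms(2), of "w \<circ> C \<circ> inv w" w] permutes_image[OF assms(1)]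
  by (simp add: permutes_inverses[OF assms(1)])

text \<open>Both factors are conjugated by the same \<open>w\<close>. The product determines
  \<open>w\<close>, and then the original factorization of \<open>C\<close> is recovered by
  conjugating back.\<close>

lemma card_cyclic_products:
  fixes lam mu :: "nat multiset" and i j :: nat
  assumes n: "n \<ge> 1" and C: "C permutes {1..n}" "cyclic_on C {1..n}"
  defines "A \<equiv> marked_class n lam i" and "B \<equiv> marked_class n mu j"
  shows "card {(s, t). s \<in> A \<and> t \<in> B \<and> cyclic_on (s \<circ> t) {1..n}} =
    fact (n - 1) * card {(s, t). s \<in> A \<and> t \<in> B \<and> C = s \<circ> t}"
proof -
  let ?W = "{w. w permutes {1..<n}}"
  let ?X = "{(s, t). s \<in> A \<and> t \<in> B \<and> C = s \<circ> t}"
  let ?Y = "{(s, t). s \<in> A \<and> t \<in> B \<and> cyclic_on (s \<circ> t) {1..n}}"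
  let ?F = "\<lambda>(w, s, t). (w \<circ> s \<circ> inv w, w \<circ> t \<circ> inv w)"
  have prod: "(w \<circ> s \<circ> inv w) \<circ> (w \<circ> t \<circ> inv w) = w \<circ> (s \<circ> t) \<circ> inv w"
    if "w permutes {1..<n}" for w s t
    by (simp add: fun_eq_iff permutes_inverses[OF that])
  have inj: "inj_on ?F (?W \<times> ?X)"
  proof (rule inj_onI)
    fix z z' assume "z \<in> ?W \<times> ?X" "z' \<in> ?W \<times> ?X" and F: "?F z = ?F z'"
    then obtain w s t w' s' t' where z: "z = (w, s, t)" "z' = (w', s', t')"
      and w: "w permutes {1..<n}" "w' permutes {1..<n}" and C12: "C = s \<circ> t" "C = s' \<circ> t'"
      by auto
    have e: "w \<circ> s \<circ> inv w = w' \<circ> s' \<circ> inv w'" "w \<circ> t \<circ> inv w = w' \<circ> t' \<circ> inv w'"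
      using F z by auto
    have "w \<circ> C \<circ> inv w = w' \<circ> C \<circ> inv w'"
      using prod[OF w(1), of s t] prod[OF w(2), of s' t'] e C12 by metis
    then have "w = w'" using n_cycle_conj_inj[OF n C w] by simp
    then show "z = z'"
      using e inv_conj(1)[OF w(1)] z by metis
  qed
  have img: "?F ` (?W \<times> ?X) = ?Y"
  proof (intro equalityI subsetI)
    fix z assume "z \<in> ?F ` (?W \<times> ?X)"
    then obtain w s t where w: "w permutes {1..<n}" and st: "s \<in> A" "t \<in> B" "C = s \<circ> t"
      and z: "z = (w \<circ> s \<circ> inv w, w \<circ> t \<circ> inv w)" by auto
    have "w permutes {1..n}" using w by (rule permutes_subset) auto
    then have "cyclic_on (w \<circ> C \<circ> inv w) {1..n}" using C(2) by (rule cyclic_on_conj)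
    then show "z \<in> ?Y"
      using marked_class_conj[OF w] st unfolding z A_def B_def by (simp add: prod[OF w] del: o_assoc)
  next
    fix z assume "z \<in> ?Y"
    then obtain s t where z: "z = (s, t)" and st: "s \<in> A" "t \<in> B" "cyclic_on (s \<circ> t) {1..n}" by auto
    have "s \<circ> t permutes {1..n}"
      using st marked_class_D(1) unfolding A_def B_def by (blast intro: permutes_compose)
    then obtain w where w: "w permutes {1..<n}" "s \<circ> t = w \<circ> C \<circ> inv w"
      using n_cycles_conj[OF n C _ st(3)] by blast
    note w' = permutes_inv[OF w(1)]
    let ?s = "inv w \<circ> s \<circ> w" and ?t = "inv w \<circ> t \<circ> w"
    have "?s \<in> A" "?t \<in> B"
      using marked_class_conj[OF w'] st unfolding A_def B_def permutes_inv_inv[OF w(1)] by auto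
    moreover have "?s \<circ> ?t = inv w \<circ> (s \<circ> t) \<circ> w"
      by (simp add: fun_eq_iff permutes_inverses[OF w(1)])
    then have "C = ?s \<circ> ?t" unfolding w(2) using inv_conj(1)[OF w(1), of C] by simp
    moreover have "z = ?F (w, ?s, ?t)" unfolding z using inv_conj(2)[OF w(1)] by simp
    ultimately show "z \<in> ?F ` (?W \<times> ?X)" using w(1) by blast
  qed
  have "card ?Y = card (?W \<times> ?X)" using card_image[OF inj] unfolding img .
  also have "\<dots> = fact (n - 1) * card ?X"
    unfolding card_cartesian_product by (subst card_permutations[of "{1..<n}" "n - 1"]) auto
  finally show ?thesis .
qed

section \<open>Coefficients in x and y\<close>

lemma in_y_mult: "in_y (f * g) = in_y f * in_y g"
proof (intro fps_ext)
  fix a b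
  show "in_y (f * g) $ b $ a = (in_y f * in_y g) $ b $ a"
    by (cases a) (simp_all add: in_y_def fps_mult_nth fps_sum_nth)
qed

lemma coeff_xy_mult: "coeff_xy (in_x f * in_y g) a b = f $ a * g $ b"
  by (simp add: coeff_xy_def in_x_def in_y_def)

lemma coeff_xy_T_series:
  assumes "k \<ge> 1"
  shows "coeff_xy (T_series n i j * in_x F * in_y G) k k =
    (R_series n i * F) $ (k - 1) * (R_series n j * G) $ (k - 1) - (S_series n i * F) $ k * (S_series n j * G) $ k"
proof -
  have in_x_mult: "in_x (f * g) = in_x f * in_x g" for f g by (simp add: in_x_def)
  have "T_series n i j * in_x F * in_y G =
      in_x (fps_X * (R_series n i * F)) * in_y (fps_X * (R_series n j * G))
      - in_x (S_series n i * F) * in_y (S_series n j * G)"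
    unfolding T_series_def in_x_mult in_y_mult by (simp only: algebra_simps)
  moreover have "coeff_xy (U - V) k k = coeff_xy U k k - coeff_xy V k k" for U V
    by (simp add: coeff_xy_def)
  ultimately show ?thesis using assms by (simp only: coeff_xy_mult) simp
qed

text \<open>All members of a marked class have the same two traces, so the sums are multiples of the
  class size. The denominator n - 1 is the dimension of V.\<close>

lemma class_form_traces:
  fixes k :: nat
  assumes n: "n \<ge> 2" and lam: "i \<in># lam" "i \<ge> 1"
  defines "A \<equiv> marked_class n lam i" and "F \<equiv> H_series (lam - {#i#}) / (1 + fps_X)"
    and "v \<equiv> tr_form k {1..<n} (polarize k {1..<n} (class_form n (marked_class n lam i) k)) / real (card {1..<n})"
  shows "v = real (card A) / (real n - 1) * (S_series n i * F) $ k"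
    and "tr_form k {1..<n} (class_form n A k) - v = real (card A) / (real n - 1) * (R_series n i * F) $ k"
proof -
  have n1: "n \<ge> 1" using n by simp
  have m: "real (card {1..<n}) = real n - 1" using n by (simp add: of_nat_diff)
  have pol: "pol_trace n s k = (S_series n i * F) $ k" if "s \<in> A" for s
    using pol_trace_marked[OF n1 that[unfolded A_def] lam] unfolding F_def by (metis fps_nth_Abs_fps)
  have ext: "(real n - 1) * ext_trace n s k - pol_trace n s k = (R_series n i * F) $ k" if "s \<in> A" for s
  proof -
    have "((of_nat n - 1) * Abs_fps (ext_trace n s) - Abs_fps (pol_trace n s)) $ k = (R_series n i * F) $ k"
      using ext_minus_pol_marked[OF n1 that[unfolded A_def] lam] unfolding F_def by simp
    moreover have "(of_nat n - 1 :: real fps) = fps_const (real n - 1)"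
      by (simp add: fps_of_nat[symmetric] fps_const_sub[symmetric] del: fps_const_sub)
    ultimately show ?thesis by simp
  qed
  have v: "v = (\<Sum>s\<in>A. pol_trace n s k) / (real n - 1)"
    unfolding v_def m A_def tr_form_polarize_class_form ..
  show "v = real (card A) / (real n - 1) * (S_series n i * F) $ k"
    unfolding v using pol by simp
  have "tr_form k {1..<n} (class_form n A k) - v = (\<Sum>s\<in>A. (real n - 1) * ext_trace n s k - pol_trace n s k) / (real n - 1)"
    unfolding v tr_form_class_form using n
    by (simp add: sum_subtractf sum_distrib_left[symmetric] diff_divide_distrib)
  also have "\<dots> = real (card A) / (real n - 1) * (R_series n i * F) $ k"
    using ext by simp
  finally show "tr_form k {1..<n} (class_form n A k) - v = real (card A) / (real n - 1) * (R_series n i * F) $ k" .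
qed

theorem mainTheorem11:
  fixes n i j :: nat and lam mu :: "nat multiset" and C :: "nat \<Rightarrow> nat"
  assumes "n \<ge> 2"
    and "is_partition_of lam n" and "is_partition_of mu n"
    and "i \<in># lam" and "j \<in># mu"
    and "C permutes {1..n}" and "cyclic_on C {1..n}"
  shows "real (card {(s1, s2). s1 \<in> marked_class n lam i \<and> s2 \<in> marked_class n mu j \<and> C = s1 \<circ> s2}) =
    real (card (marked_class n lam i)) * real (card (marked_class n mu j))
      / ((real n - 1)\<^sup>2 * fact n) *
    (\<Sum>k = 1..n - 1. (- 1) ^ (k - 1) / real ((n - 2) choose (k - 1)) *
       coeff_xy (T_series n i j
         * in_x (H_series (lam - {#i#}) / (1 + fps_X))
         * in_y (H_series (mu - {#j#}) / (1 + fps_X))) k k)"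
proof -
  let ?A = "marked_class n lam i" and ?B = "marked_class n mu j"
  let ?F = "H_series (lam - {#i#}) / (1 + fps_X)" and ?G = "H_series (mu - {#j#}) / (1 + fps_X)"
  let ?N = "card {(s1, s2). s1 \<in> ?A \<and> s2 \<in> ?B \<and> C = s1 \<circ> s2}"
  define \<kappa> where "\<kappa> = real (card ?A) * real (card ?B) / (real n - 1)\<^sup>2"
  define u where "u k = (R_series n i * ?F) $ k * (R_series n j * ?G) $ k" for k
  define v where "v k = (S_series n i * ?F) $ k * (S_series n j * ?G) $ k" for k
  define Z where "Z = (\<Sum>k = 1..n - 1. (- 1) ^ (k - 1) / real ((n - 2) choose (k - 1)) *
    coeff_xy (T_series n i j * in_x ?F * in_y ?G) k k)"
  have n: "n \<ge> 1" using assms(1) by simp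
  have pos: "i \<ge> 1" "j \<ge> 1"
    using assms(2-5) by (auto simp: is_partition_of_def Suc_le_eq intro!: Nat.gr0I)
  have perm: "s \<circ> t permutes {1..n}" if "s \<in> ?A" "t \<in> ?B" for s t
    using that marked_class_D(1) by (blast intro: permutes_compose)
  have pairing: "(\<Sum>s\<in>?A. \<Sum>t\<in>?B. ext_trace n (s \<circ> t) k) =
      \<kappa> * (u k / real ((n - 2) choose k) + (if k = 0 then 0 else v k / real ((n - 2) choose (k - 1))))"
    if k: "k < n" for k
  proof -
    have S: "finite {1..<n}" "{1..<n} \<noteq> {}" "k \<le> card {1..<n}" "card {1..<n} - 1 = n - 2"
      using assms(1) k by auto
    note tA = class_form_traces[OF assms(1,4) pos(1), of k] and tB = class_form_traces[OF assms(1,5) pos(2), of k]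
    have "(\<Sum>s\<in>?A. \<Sum>t\<in>?B. ext_trace n (s \<circ> t) k) = (\<Sum>f\<in>tuples k {1..<n}. \<Sum>g\<in>tuples k {1..<n}.
        class_form n ?A k f g * class_form n ?B k g f) / (fact k)\<^sup>2"
      by (rule sum_ext_trace_comp[OF n]) (rule marked_class_D(1))
    also have "\<dots> = (real (card ?A) / (real n - 1) * (R_series n i * ?F) $ k) *
        (real (card ?B) / (real n - 1) * (R_series n j * ?G) $ k) / real ((n - 2) choose k) +
        (if k = 0 then 0 else (real (card ?A) / (real n - 1) * (S_series n i * ?F) $ k) *
        (real (card ?B) / (real n - 1) * (S_series n j * ?G) $ k) / real ((n - 2) choose (k - 1)))"
      unfolding alt_inv_trace_product[OF alt_inv_class_form alt_inv_class_form S(1-3)] S(4) tA(2) tB(2)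
      unfolding tA(1) tB(1) ..
    also have "\<dots> = \<kappa> * (u k / real ((n - 2) choose k) + (if k = 0 then 0 else v k / real ((n - 2) choose (k - 1))))"
      by (simp add: \<kappa>_def u_def v_def power2_eq_square distrib_left mult_ac)
    finally show ?thesis .
  qed
  have "fact (n - 1) * real ?N = real (card {(s, t). s \<in> ?A \<and> t \<in> ?B \<and> cyclic_on (s \<circ> t) {1..n}})"
    unfolding card_cyclic_products[OF n assms(6,7)] by simp
  also have "\<dots> = (\<Sum>s\<in>?A. \<Sum>t\<in>?B. of_bool (cyclic_on (s \<circ> t) {1..n}))"
  proof -
    have "{(s, t). s \<in> ?A \<and> t \<in> ?B \<and> cyclic_on (s \<circ> t) {1..n}} =
        {z \<in> ?A \<times> ?B. cyclic_on (fst z \<circ> snd z) {1..n}}" by auto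
    then have "real (card {(s, t). s \<in> ?A \<and> t \<in> ?B \<and> cyclic_on (s \<circ> t) {1..n}}) =
        (\<Sum>z\<in>?A \<times> ?B. of_bool (cyclic_on (fst z \<circ> snd z) {1..n}))"
      by (simp add: of_bool_def sum.inter_filter[symmetric])
    then show ?thesis by (simp only: sum.cartesian_product split_def)
  qed
  finally have count: "fact (n - 1) * real ?N = (\<Sum>s\<in>?A. \<Sum>t\<in>?B. of_bool (cyclic_on (s \<circ> t) {1..n}))" .
  \<comment> \<open>The factor n is the value of the alternating sum of traces at an n-cycle; with
    (n - 1)! it makes n!.\<close>
  have "real n * (fact (n - 1) * real ?N) =
      (\<Sum>s\<in>?A. \<Sum>t\<in>?B. real n * of_bool (cyclic_on (s \<circ> t) {1..n}))"
    unfolding count sum_distrib_left ..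
  also have "\<dots> = (\<Sum>s\<in>?A. \<Sum>t\<in>?B. \<Sum>k<n. (- 1) ^ k * ext_trace n (s \<circ> t) k)"
    by (intro sum.cong refl alternating_ext_trace[OF n perm, symmetric])
  also have "\<dots> = (\<Sum>s\<in>?A. \<Sum>k<n. \<Sum>t\<in>?B. (- 1) ^ k * ext_trace n (s \<circ> t) k)"
    by (rule sum.cong[OF refl], rule sum.swap)
  also have "\<dots> = (\<Sum>k<n. \<Sum>s\<in>?A. \<Sum>t\<in>?B. (- 1) ^ k * ext_trace n (s \<circ> t) k)"
    by (rule sum.swap)
  also have "\<dots> = (\<Sum>k<n. (- 1) ^ k * (\<kappa> * (u k / real ((n - 2) choose k) +
      (if k = 0 then 0 else v k / real ((n - 2) choose (k - 1))))))"
    unfolding sum_distrib_left[symmetric] using pairing by simp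
  also have "\<dots> = \<kappa> * ((\<Sum>k<n. (- 1) ^ k * (u k / real ((n - 2) choose k))) +
      (\<Sum>k<n. if k = 0 then 0 else (- 1) ^ k * (v k / real ((n - 2) choose (k - 1)))))"
    unfolding sum.distrib[symmetric] sum_distrib_left by (intro sum.cong refl) (simp add: algebra_simps)
  also have "(\<Sum>k<n. (- 1) ^ k * (u k / real ((n - 2) choose k))) =
      (\<Sum>k<n - 1. (- 1) ^ k * (u k / real ((n - 2) choose k)))"
  proof -
    \<comment> \<open>The term k = n - 1 drops out: the binomial is 0 and division by 0 gives 0. The
      corresponding summand has dimension 0.\<close>
    have "n = Suc (n - 1)" "(n - 2) choose (n - 1) = 0" using assms(1) by (auto simp: binomial_eq_0)
    then show ?thesis by (metis (no_types, lifting) add.right_neutral div_by_0 mult_zero_right of_nat_0 sum.lessThan_Suc)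
  qed
  \<comment> \<open>After this shift both parts have the same binomial, and the S part has the
    opposite sign, as in T.\<close>
  also have "\<dots> = (\<Sum>k = 1..n - 1. (- 1) ^ (k - 1) * (u (k - 1) / real ((n - 2) choose (k - 1))))"
    by (rule sum.reindex_bij_witness[of _ "\<lambda>k. k - 1" Suc]) auto
  also have "(\<Sum>k<n. if k = 0 then 0 else (- 1) ^ k * (v k / real ((n - 2) choose (k - 1)))) =
      (\<Sum>k = 1..n - 1. - ((- 1) ^ (k - 1) * (v k / real ((n - 2) choose (k - 1)))))"
  proof (rule sum.mono_neutral_cong_right)
    fix k assume "k \<in> {1..n - 1}"
    then obtain l where "k = Suc l" by (cases k) auto
    then show "(if k = 0 then 0 else (- 1) ^ k * (v k / real ((n - 2) choose (k - 1)))) =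
      - ((- 1) ^ (k - 1) * (v k / real ((n - 2) choose (k - 1))))" by simp
  qed (use assms(1) in auto)
  also have "\<kappa> * ((\<Sum>k = 1..n - 1. (- 1) ^ (k - 1) * (u (k - 1) / real ((n - 2) choose (k - 1)))) +
      (\<Sum>k = 1..n - 1. - ((- 1) ^ (k - 1) * (v k / real ((n - 2) choose (k - 1)))))) =
      \<kappa> * (\<Sum>k = 1..n - 1. (- 1) ^ (k - 1) / real ((n - 2) choose (k - 1)) *
        coeff_xy (T_series n i j * in_x ?F * in_y ?G) k k)"
    unfolding sum.distrib[symmetric]
    by (intro arg_cong[of _ _ "\<lambda>x. \<kappa> * x"] sum.cong refl)
      (simp add: coeff_xy_T_series u_def v_def diff_divide_distrib right_diff_distrib)
  finally have "real n * (fact (n - 1) * real ?N) = \<kappa> * Z" unfolding Z_def .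
  moreover have "fact n = real n * fact (n - 1)" using fact_reduce[of n] n by simp
  ultimately have "fact n * real ?N = \<kappa> * Z" by (simp only: mult.assoc)
  moreover have "x = y / fact n" if "fact n * x = y" for x y :: real
    using that by (simp add: field_simps)
  ultimately have "real ?N = \<kappa> * Z / fact n" by blast
  also have "\<dots> = real (card ?A) * real (card ?B) / ((real n - 1)\<^sup>2 * fact n) * Z"
    by (simp add: \<kappa>_def)
  finally show ?thesis unfolding Z_def .
qed

end
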